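(* Assume $\mathrm{cov}(\mathcal M)=\mathfrak c$. A zero-closed semigroup $X$ is polybounded if one of the following conditions is satisfied: (1) $X$ has a separable complete subinvariant metric; (2) $X$ admits a compact Hausdorff semigroup topology.
   Context: $\mathfrak c$ is the cardinality of the continuum and $\mathrm{cov}(\mathcal M)$ is the smallest cardinality of a cover of the real line by meager sets. For a semigroup $X$, the $0$-extension of $X$ is the semigroup $X^0=X\cup\{0\}$, where $0\notin X$ is a new element with $0x=0=x0$ for every $x\in X^0$; the $1$-extension of $X$ is the semigroup $X^1=X\cup\{1\}$, where $1\notin X$ is a new element with $1x=x=x1$ for every $x\in X^1$. A topology on a semigroup $S$ is a semigroup topology if the binary operation $S\times S\to S$ is continuous. A semigroup $X$ (carrying no topology) is zero-closed if $X$ is a closed subset of $X^0$ for every Hausdorff semigroup topology on $X^0$. A subset $A$ of a semigroup $X$ is algebraic if $A=\{x\in X: a_0xa_1x\cdots xa_n=b\}$ for some integer $n\ge 1$, some $b\in X$ and some $a_0,\dots,a_n\in X^1$. A semigroup $X$ is polybounded if $X$ is the union of finitely many algebraic subsets of $X$. A metric $d$ on a semigroup $X$ is subinvariant if $d(axb,ayb)\le d(x,y)$ for all $x,y\in X$ and $a,b\in X^1$. *)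

theory Defs
  imports "HOL-Analysis.Analysis"
begin

unbundle cardinal_syntax

section \<open>The cardinal cov(M)\<close>

definition nowhere_dense :: "'a::topological_space set \<Rightarrow> bool" where
  "nowhere_dense A \<longleftrightarrow> interior (closure A) = {}"

definition meager :: "'a::topological_space set \<Rightarrow> bool" where
  "meager A \<longleftrightarrow> (\<exists>\<N>. countable \<N> \<and> (\<forall>N\<in>\<N>. nowhere_dense N) \<and> A = \<Union>\<N>)"

definition meager_cover :: "real set set \<Rightarrow> bool" where
  "meager_cover \<F> \<longleftrightarrow> (\<forall>A\<in>\<F>. meager A) \<and> \<Union>\<F> = UNIV"

text \<open>A cardinal is represented by a cardinal order, here the one on a cover of least size; it is
  determined only up to \<open>=o\<close>, and must be compared with other cardinals by \<open>=o\<close> and \<open>\<le>o\<close>.\<close>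

definition cov_M :: "real set rel" where
  "cov_M = |SOME \<F>. meager_cover \<F> \<and> (\<forall>\<G>. meager_cover \<G> \<longrightarrow> |\<F>| \<le>o |\<G>| )|"

lemma meager_cover_singletons: "meager_cover (range (\<lambda>x. {x}))"
proof -
  have "meager {x}" for x :: real
    unfolding meager_def nowhere_dense_def by (intro exI[of _ "{{x}}"]) simp
  then show ?thesis
    by (auto simp: meager_cover_def)
qed

lemma cov_M:
  obtains \<F> where "meager_cover \<F>" "cov_M = |\<F>|" "\<And>\<G>. meager_cover \<G> \<Longrightarrow> cov_M \<le>o |\<G>|"
proof -
  have "card_of ` Collect meager_cover \<noteq> {}"
    using meager_cover_singletons by auto
  moreover have "\<forall>r \<in> card_of ` Collect meager_cover. Card_order r"
    by (simp add: card_of_Card_order)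
  ultimately have "\<exists>r \<in> card_of ` Collect meager_cover. \<forall>r' \<in> card_of ` Collect meager_cover. r \<le>o r'"
    by (rule exists_minim_Card_order)
  then have "\<exists>\<F>. meager_cover \<F> \<and> (\<forall>\<G>. meager_cover \<G> \<longrightarrow> |\<F>| \<le>o |\<G>| )"
    by simp
  from someI_ex[OF this] show ?thesis
    by (intro that[of "SOME \<F>. meager_cover \<F> \<and> (\<forall>\<G>. meager_cover \<G> \<longrightarrow> |\<F>| \<le>o |\<G>| )"])
       (simp_all add: cov_M_def)
qed

section \<open>Extensions of semigroups\<close>

text \<open>A semigroup \<open>X\<close> is the universe of a type of class \<open>semigroup_mult\<close>. In both
  extensions the new element is added even if \<open>X\<close> already has a zero or a unit.\<close>

datatype 'a zero_ext = Zero | In0 'a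

instantiation zero_ext :: (semigroup_mult) "{semigroup_mult, mult_zero}"
begin

definition zero_zero_ext :: "'a zero_ext" where
  "zero_zero_ext = Zero"

fun times_zero_ext :: "'a zero_ext \<Rightarrow> 'a zero_ext \<Rightarrow> 'a zero_ext" where
  "times_zero_ext (In0 x) (In0 y) = In0 (x * y)"
| "times_zero_ext Zero y = Zero"
| "times_zero_ext x Zero = Zero"

instance
proof
  fix a b c :: "'a zero_ext"
  show "a * b * c = a * (b * c)"
    by (cases a; cases b; cases c) (simp_all add: mult.assoc)
  show "0 * a = 0" "a * 0 = 0"
    by (cases a; simp add: zero_zero_ext_def)+
qed

end

datatype 'a one_ext = One | In1 (out1: 'a)

instantiation one_ext :: (semigroup_mult) monoid_mult
begin

definition one_one_ext :: "'a one_ext" where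
  "one_one_ext = One"

fun times_one_ext :: "'a one_ext \<Rightarrow> 'a one_ext \<Rightarrow> 'a one_ext" where
  "times_one_ext (In1 x) (In1 y) = In1 (x * y)"
| "times_one_ext One y = y"
| "times_one_ext x One = x"

instance
proof
  fix a b c :: "'a one_ext"
  show "a * b * c = a * (b * c)"
    by (cases a; cases b; cases c) (simp_all add: mult.assoc)
  show "1 * a = a" "a * 1 = a"
    by (cases a; simp add: one_one_ext_def)+
qed

end

section \<open>Zero-closed and polybounded semigroups\<close>

definition semigroup_topology :: "'a::semigroup_mult topology \<Rightarrow> bool" where
  "semigroup_topology T \<longleftrightarrow>
     topspace T = UNIV \<and> continuous_map (prod_topology T T) T (\<lambda>(x, y). x * y)"

definition zero_closed :: "'a::semigroup_mult itself \<Rightarrow> bool" where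
  "zero_closed _ \<longleftrightarrow>
     (\<forall>T :: 'a zero_ext topology. semigroup_topology T \<and> Hausdorff_space T \<longrightarrow>
        closedin T (range In0))"

text \<open>\<open>sg_poly a n x\<close> is the product \<open>a\<^sub>0 x a\<^sub>1 x \<dots> x a\<^sub>n\<close>, computed in the 1-extension.\<close>

primrec sg_poly :: "(nat \<Rightarrow> 'a one_ext) \<Rightarrow> nat \<Rightarrow> 'a::semigroup_mult \<Rightarrow> 'a one_ext" where
  "sg_poly a 0 x = a 0"
| "sg_poly a (Suc n) x = sg_poly a n x * In1 x * a (Suc n)"

definition algebraic_subset :: "'a::semigroup_mult set \<Rightarrow> bool" where
  "algebraic_subset A \<longleftrightarrow> (\<exists>n\<ge>1. \<exists>a b. A = {x. sg_poly a n x = In1 b})"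

definition polybounded :: "'a::semigroup_mult itself \<Rightarrow> bool" where
  "polybounded _ \<longleftrightarrow>
     (\<exists>\<A> :: 'a set set. finite \<A> \<and> (\<forall>A\<in>\<A>. algebraic_subset A) \<and> \<Union>\<A> = UNIV)"

text \<open>The products \<open>a x b\<close> are formed in the 1-extension; they always lie in the range of \<open>In1\<close>,
  so \<open>out1\<close> is never applied to \<open>One\<close>.\<close>

definition subinvariant :: "('a::semigroup_mult \<Rightarrow> 'a \<Rightarrow> real) \<Rightarrow> bool" where
  "subinvariant d \<longleftrightarrow>
     (\<forall>x y a b. d (out1 (a * In1 x * b)) (out1 (a * In1 y * b)) \<le> d x y)"

lemma range_In1_two_sided: "a * In1 x * b \<in> range In1"
  by (cases a; cases b) auto

end

theory Submission
  imports Defs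
begin

text \<open>
  The proof turns a failure of polyboundedness into a Hausdorff semigroup topology on \<open>X\<^sup>0\<close> in which
  \<open>X\<close> is discrete and \<open>0\<close> is not isolated. Such a topology is a filter base of nonempty sets \<open>V\<close>
  with empty intersection that absorbs products and translations
  (\<open>zero_closed_no_filter\<close>). The sets \<open>V\<close> consist of, or are close to, values \<open>p(x\<^sub>k)\<close> for large
  \<open>k\<close>, where the sequence \<open>x\<close> is chosen recursively and the coefficients of the polynomial \<open>p\<close> come
  from a set \<open>L\<^sub>k\<close> that contains the previous \<open>x\<^sub>j\<close>; \<open>x\<^sub>k\<close> is chosen so that \<open>p(x\<^sub>k)\<close> avoids
  what has to be separated from \<open>0\<close>. The construction is carried out twice.

  With indices running through the continuum and a congruence with at most continuum many classes, it
  shows that \<open>X\<close> is covered, modulo the congruence, by fewer than continuum many algebraic sets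
  (\<open>zero_closed_small_cover\<close>). If the congruence is the one of a separable subinvariant pseudometric
  and \<open>Z\<close> is a complete nonempty set, then the hypothesis on category, carried from the real line to
  \<open>Z\<close> by \<open>category_map\<close>, yields one algebraic set with nonempty interior in \<open>Z\<close>
  (\<open>algebraic_set_with_interior\<close>).

  With indices in the natural numbers, the letters of a word are approximated by a countable dense
  sequence, so at each step only finitely many words matter. This does not separate a
  given point from \<open>0\<close>, but it is enough to separate countably many open sets \<open>U\<^sub>j\<close>, provided that every
  point is moved into some \<open>U\<^sub>j\<close> by a polynomial; and that is possible if \<open>U\<^sub>j\<close> meets the ideal
  generated by some \<open>z\<^sub>j\<close> only inside finitely many algebraic sets, because \<open>x\<^sub>k\<close> can be taken in
  the ideals of \<open>z\<^sub>0, \<dots>, z\<^sub>k\<close> (\<open>polybounded_of_escape\<close>).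

  Whether such \<open>U\<^sub>j\<close> exist is decided by the closed ideal \<open>core T\<close> of the points that no polynomial
  moves into an open set of this kind. If it is empty, the second construction applies. If it is not,
  then no nonempty relatively open part of it lies in an algebraic set. For a complete metric this
  contradicts \<open>algebraic_set_with_interior\<close> at once. For a compact topology the space need not be
  metrizable nor have at most continuum many points, and one first needs a metrizable quotient that
  still sees that algebraic sets have empty interior in the core; a continuous subinvariant
  pseudometric that defines one is obtained by a countable closing-off argument, with compactness
  applied to the coefficients of the polynomials (\<open>admissible_generic\<close>).\<close>

section \<open>Polynomials as words\<close>

text \<open>A polynomial with coefficients in \<open>X\<^sup>1\<close> is encoded as a word in which \<open>None\<close> stands for the
  variable and \<open>Some a\<close> for the constant \<open>a\<close>; an absent constant is the unit. Products of polynomials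
  are concatenations, and words over a set of constants are easy to count. The word must be nonempty
  for \<open>out1\<close> to be meaningful.\<close>

definition weval :: "'a option list \<Rightarrow> 'a::semigroup_mult \<Rightarrow> 'a" where
  "weval w x = out1 (prod_list (map (\<lambda>l. In1 (case l of None \<Rightarrow> x | Some a \<Rightarrow> a)) w))"

lemma prod_list_In1:
  assumes "xs \<noteq> []"
  shows "prod_list (map (\<lambda>l. In1 (f l)) xs) \<in> range (In1 :: 'a::semigroup_mult \<Rightarrow> _)"
  using assms
proof (induction xs)
  case (Cons x xs)
  then show ?case
  proof (cases "xs = []")
    case True
    then show ?thesis by (simp add: one_one_ext_def)
  next
    case False
    with Cons.IH obtain y where "prod_list (map (\<lambda>l. In1 (f l)) xs) = In1 y" by blast
    then show ?thesis by simp
  qed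
qed simp

lemma In1_weval:
  assumes "w \<noteq> []"
  shows "In1 (weval w x) = prod_list (map (\<lambda>l. In1 (case l of None \<Rightarrow> x | Some a \<Rightarrow> a)) w)"
  using prod_list_In1[OF assms, of "\<lambda>l. case l of None \<Rightarrow> x | Some a \<Rightarrow> a"]
  by (auto simp: weval_def)

lemma weval_single [simp]: "weval [None] x = x" "weval [Some a] x = a"
  by (simp_all add: weval_def one_one_ext_def)

lemma weval_append:
  assumes "v \<noteq> []" "w \<noteq> []"
  shows "weval (v @ w) x = weval v x * weval w x"
proof -
  have "In1 (weval (v @ w) x) = In1 (weval v x) * In1 (weval w x)"
    using In1_weval[of "v @ w" x] In1_weval[OF assms(1), of x] In1_weval[OF assms(2), of x] assms
    by (simp only: append_is_Nil_conv map_append prod_list.append simp_thms)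
  then show ?thesis by simp
qed

lemma weval_Cons:
  assumes "w \<noteq> []"
  shows "weval (l # w) x = weval [l] x * weval w x"
  using weval_append[of "[l]" w] assms by simp

lemma weval_induct [consumes 1, case_names letter Cons]:
  assumes "w \<noteq> []" "\<And>l. P [l]" "\<And>l w. w \<noteq> [] \<Longrightarrow> P w \<Longrightarrow> P (l # w)"
  shows "P w"
  using assms by (induction w) (metis)+

lemma weval_constant:
  assumes "None \<notin> set w"
  shows "weval w x = weval w y"
proof -
  have "map (\<lambda>l. In1 (case l of None \<Rightarrow> x | Some a \<Rightarrow> a)) w = map (\<lambda>l. In1 (case l of None \<Rightarrow> y | Some a \<Rightarrow> a)) w"
    using assms by (intro map_cong) (auto split: option.split)
  then show ?thesis by (simp only: weval_def)
qed

text \<open>Neighbouring constants of the word are multiplied together to give the coefficients of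
  \<open>sg_poly\<close>, which are changed one at a time as letters are appended on the right.\<close>

lemma algebraic_weval:
  assumes "None \<in> set w"
  shows "algebraic_subset {x. weval w x = (b :: 'a::semigroup_mult)}"
proof -
  have "\<exists>a n. (None \<in> set w \<longrightarrow> n \<ge> 1) \<and>
          (\<forall>x :: 'a. prod_list (map (\<lambda>l. In1 (case l of None \<Rightarrow> x | Some a \<Rightarrow> a)) w) = sg_poly a n x)"
  proof (induction w rule: rev_induct)
    case Nil
    show ?case by (intro exI[of _ "\<lambda>_. 1"] exI[of _ 0]) simp
  next
    case (snoc l w)
    then obtain a n where a: "None \<in> set w \<longrightarrow> n \<ge> 1"
      "\<And>x. prod_list (map (\<lambda>l. In1 (case l of None \<Rightarrow> x | Some a \<Rightarrow> a)) w) = sg_poly a n x"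
      by blast
    have cong: "sg_poly a' m x = sg_poly a m x" if "\<And>i. i \<le> m \<Longrightarrow> a' i = a i" for a' m x
      using that by (induction m) auto
    show ?case
    proof (cases l)
      case None
      have "sg_poly (a(Suc n := 1)) n x = sg_poly a n x" for x
        by (rule cong) simp
      then show ?thesis
        by (intro exI[of _ "a(Suc n := 1)"] exI[of _ "Suc n"]) (simp add: a None fun_upd_same del: fun_upd_apply)
    next
      case (Some s)
      have "sg_poly (a(n := a n * In1 s)) n x = sg_poly a n x * In1 s" for x
      proof (cases n)
        case (Suc m)
        have "sg_poly (a(n := a n * In1 s)) m x = sg_poly a m x"
          by (rule cong) (simp add: Suc)
        then show ?thesis by (simp add: Suc mult.assoc)
      qed simp
      then show ?thesis
        using a Some by (intro exI[of _ "a(n := a n * In1 s)"] exI[of _ n])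
            (auto simp del: fun_upd_apply)
    qed
  qed
  then obtain a n where "n \<ge> 1"
    "\<And>x :: 'a. prod_list (map (\<lambda>l. In1 (case l of None \<Rightarrow> x | Some a \<Rightarrow> a)) w) = sg_poly a n x"
    using assms by blast
  moreover from assms have "w \<noteq> []" by auto
  ultimately have "weval w x = b \<longleftrightarrow> sg_poly a n x = In1 b" for x
    by (metis In1_weval one_ext.inject)
  then have "{x. weval w x = b} = {x. sg_poly a n x = In1 b}" by simp
  with \<open>n \<ge> 1\<close> show ?thesis unfolding algebraic_subset_def by blast
qed

definition wsubst :: "'a option list \<Rightarrow> 'a option list \<Rightarrow> 'a option list" where
  "wsubst v w = concat (map (\<lambda>l. case l of None \<Rightarrow> v | Some a \<Rightarrow> [Some a]) w)"

lemma wsubst_ne: "v \<noteq> [] \<Longrightarrow> w \<noteq> [] \<Longrightarrow> wsubst v w \<noteq> []"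
  by (cases w) (auto simp: wsubst_def split: option.splits)

lemma None_in_wsubst: "None \<in> set v \<Longrightarrow> None \<in> set w \<Longrightarrow> None \<in> set (wsubst v w)"
  by (force simp: wsubst_def)

lemma weval_wsubst:
  assumes "w \<noteq> []" "v \<noteq> []"
  shows "weval (wsubst v w) x = weval w (weval v x)"
  using assms(1)
proof (induction w rule: weval_induct)
  case (letter l)
  then show ?case by (cases l) (simp_all add: wsubst_def)
next
  case (Cons l w)
  have "wsubst v (l # w) = wsubst v [l] @ wsubst v w"
    by (simp add: wsubst_def)
  moreover have "weval (wsubst v [l]) x = weval [l] (weval v x)"
    by (cases l) (simp_all add: wsubst_def)
  ultimately show ?case
    using Cons assms(2) by (simp add: weval_append weval_Cons wsubst_ne)
qed

text \<open>An algebraic set is defined by a word, so substitution of polynomials gives the preimage.\<close>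

lemma algebraic_subset_preimage:
  assumes "algebraic_subset A" "None \<in> set w"
  shows "algebraic_subset {x. weval w x \<in> A}"
proof -
  obtain a n b where n: "n \<ge> 1" and A: "A = {x. sg_poly a n x = In1 b}"
    using assms(1) unfolding algebraic_subset_def by blast
  define let1 where "let1 c = (case c of One \<Rightarrow> [] | In1 s \<Rightarrow> [Some s])" for c :: "'a one_ext"
  define u where "u = let1 (a 0) @ concat (map (\<lambda>i. None # let1 (a (Suc i))) [0..<n])"
  have let1: "prod_list (map (\<lambda>l. In1 (case l of None \<Rightarrow> x | Some a \<Rightarrow> a)) (let1 c)) = c" for x c
    by (cases c) (auto simp: let1_def one_one_ext_def)
  have "prod_list (map (\<lambda>l. In1 (case l of None \<Rightarrow> x | Some a \<Rightarrow> a))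
      (let1 (a 0) @ concat (map (\<lambda>i. None # let1 (a (Suc i))) [0..<m]))) = sg_poly a m x" for m x
    by (induction m) (simp_all add: let1 mult.assoc[symmetric])
  then have u: "prod_list (map (\<lambda>l. In1 (case l of None \<Rightarrow> x | Some a \<Rightarrow> a)) u) = sg_poly a n x" for x
    by (simp add: u_def)
  have uN: "None \<in> set u" using n by (auto simp: u_def)
  then have ne: "u \<noteq> []" by auto
  have "sg_poly a n x = In1 b \<longleftrightarrow> weval u x = b" for x
    using In1_weval[OF ne, of x] u[of x] by (metis one_ext.inject)
  then have "A = {x. weval u x = b}"
    by (simp add: A)
  then have "{x. weval w x \<in> A} = {x. weval (wsubst w u) x = b}"
    using ne assms(2) by (subst weval_wsubst) auto
  with algebraic_weval[OF None_in_wsubst[OF assms(2) uN]] show ?thesis by simp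
qed

definition words :: "'a set \<Rightarrow> 'a option list set" where
  "words L = {w. None \<in> set w \<and> set w \<subseteq> insert None (Some ` L)}"

definition plug :: "'a \<Rightarrow> 'a option list \<Rightarrow> 'a option list" where
  "plug x w = map (\<lambda>l. Some (case l of None \<Rightarrow> x | Some a \<Rightarrow> a)) w"

lemma weval_plug: "weval (plug x w) y = weval w x"
  by (simp add: weval_def plug_def comp_def)

lemma words_ne: "w \<in> words L \<Longrightarrow> w \<noteq> []"
  by (auto simp: words_def)

lemma set_plug: "w \<in> words L \<Longrightarrow> set (plug x w) \<subseteq> Some ` insert x L"
  by (auto simp: words_def plug_def split: option.splits)

lemma words_append:
  "v \<in> words L \<Longrightarrow> set w \<subseteq> insert None (Some ` L) \<Longrightarrow> v @ w \<in> words L"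
  "v \<in> words L \<Longrightarrow> set w \<subseteq> insert None (Some ` L) \<Longrightarrow> w @ v \<in> words L"
  by (auto simp: words_def)

text \<open>In the recursive constructions below, a value \<open>weval v x\<close> at an earlier point \<open>x\<close> is multiplied by a
  value \<open>weval w y\<close> at a later point \<open>y\<close>. Since the constants available at the later stage include \<open>x\<close>
  and the earlier constants, the product is again the value at \<open>y\<close> of a word of that stage.\<close>

lemma words_mult:
  assumes "v \<in> words L" "w \<in> words M" "x = y \<and> L = M \<or> insert x L \<subseteq> M"
  shows "\<exists>u\<in>words M. length u = length v + length w \<and> weval u y = weval v x * weval w y" (is ?l)
    and "\<exists>u\<in>words M. length u = length v + length w \<and> weval u y = weval w y * weval v x" (is ?r)
proof -
  obtain v' where v': "set v' \<subseteq> insert None (Some ` M)" "length v' = length v" "weval v' y = weval v x"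
  proof (cases "x = y \<and> L = M")
    case True
    then show ?thesis using that[of v] assms(1) by (auto simp: words_def)
  next
    case False
    with assms(3) set_plug[OF assms(1), of x] have "set (plug x v) \<subseteq> insert None (Some ` M)" by blast
    then show ?thesis by (intro that[of "plug x v"]) (simp_all add: weval_plug, simp add: plug_def)
  qed
  have ne: "v' \<noteq> []" "w \<noteq> []" using v'(2) words_ne assms(1,2) by fastforce+
  show ?l using v' ne words_append(2)[OF assms(2) v'(1)] by (intro bexI[of _ "v' @ w"]) (simp_all add: weval_append)
  show ?r using v' ne words_append(1)[OF assms(2) v'(1)] by (intro bexI[of _ "w @ v'"]) (simp_all add: weval_append)
qed

section \<open>Filters converging to the adjoined zero\<close>

text \<open>If no point belonged to all \<open>V i\<close>, the sets \<open>V i \<union> {0}\<close> would be the basic neighbourhoods of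
  \<open>0\<close> for a Hausdorff semigroup topology on \<open>X\<^sup>0\<close> in which the points of \<open>X\<close> are isolated, and
  \<open>X\<close> would not be closed because the \<open>V i\<close> are nonempty.\<close>

lemma zero_closed_no_filter:
  fixes V :: "'i \<Rightarrow> 'a::semigroup_mult set"
  assumes zc: "zero_closed TYPE('a)"
    and ne: "\<And>i. V i \<noteq> {}"
    and dir: "\<And>i j. \<exists>k. V k \<subseteq> V i \<inter> V j"
    and mult: "\<And>i. \<exists>j. \<forall>x\<in>V j. \<forall>y\<in>V j. x * y \<in> V i"
    and left: "\<And>i a. \<exists>j. \<forall>x\<in>V j. a * x \<in> V i"
    and right: "\<And>i a. \<exists>j. \<forall>x\<in>V j. x * a \<in> V i"
  obtains b where "\<And>i. b \<in> V i"
proof (rule ccontr)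
  assume "\<not> thesis"
  with that have out: "\<exists>i. b \<notin> V i" for b by blast
  define op where "op S \<longleftrightarrow> (Zero \<in> S \<longrightarrow> (\<exists>i. In0 ` V i \<subseteq> S))" for S
  have istop: "istopology op"
    unfolding istopology_def
  proof (intro conjI allI impI)
    fix S S' assume "op S" "op S'"
    then show "op (S \<inter> S')"
      using dir unfolding op_def by (metis IntE Int_subset_iff image_mono subset_trans)
  next
    fix K assume "\<forall>S\<in>K. op S"
    then show "op (\<Union>K)" unfolding op_def by (metis UnionE Union_upper subset_trans)
  qed
  define T where "T = topology op"
  have openT: "openin T S \<longleftrightarrow> op S" for S
    by (simp add: T_def istop topology_inverse')
  have open_nz: "openin T S" if "Zero \<notin> S" for S using that by (simp add: openT op_def)
  have open_z: "openin T (insert Zero (In0 ` V i))" for i by (auto simp: openT op_def)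
  have topT: "topspace T = UNIV"
    using ne by (metis UNIV_eq_I openT openin_subset subset_UNIV op_def top.extremum_uniqueI)
  have cont: "continuous_map (prod_topology T T) T (\<lambda>(x, y). x * y)"
    unfolding continuous_map_atin limitin_def topspace_prod_topology split_paired_Ball_Sigma prod.case
  proof (intro ballI conjI allI impI)
    fix p q :: "'a zero_ext"
    show "p * q \<in> topspace T" by (simp add: topT)
    fix S assume "openin T S \<and> p * q \<in> S"
    then have S: "openin T S" "p * q \<in> S" by simp_all
    have "\<exists>A B. openin T A \<and> openin T B \<and> p \<in> A \<and> q \<in> B \<and> (\<forall>x\<in>A. \<forall>y\<in>B. x * y \<in> S)"
    proof (cases p)
      case p: Zero
      with S have "Zero \<in> S" by simp
      with S(1) obtain i where i: "In0 ` V i \<subseteq> S" by (auto simp: openT op_def)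
      show ?thesis
      proof (cases q)
        case Zero
        obtain j where j: "\<forall>x\<in>V j. \<forall>y\<in>V j. x * y \<in> V i" using mult by blast
        show ?thesis
          using p Zero open_z[of j] j i \<open>Zero \<in> S\<close>
          by (intro exI[of _ "insert Zero (In0 ` V j)"]) auto
      next
        case (In0 a)
        obtain j where j: "\<forall>x\<in>V j. x * a \<in> V i" using right by blast
        show ?thesis
          using p In0 open_z[of j] j i \<open>Zero \<in> S\<close> open_nz[of "{In0 a}"]
          by (intro exI[of _ "insert Zero (In0 ` V j)"] exI[of _ "{In0 a}"]) auto
      qed
    next
      case p: (In0 a)
      show ?thesis
      proof (cases q)
        case Zero
        with S p have "Zero \<in> S" by simp
        with S(1) obtain i where i: "In0 ` V i \<subseteq> S" by (auto simp: openT op_def)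
        obtain j where j: "\<forall>x\<in>V j. a * x \<in> V i" using left by blast
        show ?thesis
          using p Zero open_z[of j] j i \<open>Zero \<in> S\<close> open_nz[of "{In0 a}"]
          by (intro exI[of _ "{In0 a}"] exI[of _ "insert Zero (In0 ` V j)"]) auto
      next
        case (In0 b)
        show ?thesis
          using p In0 S open_nz[of "{In0 a}"] open_nz[of "{In0 b}"]
          by (intro exI[of _ "{In0 a}"] exI[of _ "{In0 b}"]) auto
      qed
    qed
    then obtain A B where AB: "openin T A" "openin T B" "p \<in> A" "q \<in> B" "\<forall>x\<in>A. \<forall>y\<in>B. x * y \<in> S"
      by blast
    have "openin (prod_topology T T) (A \<times> B)" using AB by (simp add: openin_prod_Times_iff)
    then show "\<forall>\<^sub>F x in atin (prod_topology T T) (p, q). (case x of (x, y) \<Rightarrow> x * y) \<in> S"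
      using AB unfolding eventually_atin by (intro disjI2 exI[of _ "A \<times> B"]) auto
  qed
  have sep: "\<exists>A B. openin T A \<and> openin T B \<and> Zero \<in> A \<and> In0 b \<in> B \<and> disjnt A B" for b
  proof -
    obtain i where "b \<notin> V i" using out by blast
    then show ?thesis
      using open_z[of i] open_nz[of "{In0 b}"]
      by (intro exI[of _ "insert Zero (In0 ` V i)"] exI[of _ "{In0 b}"]) (auto simp: disjnt_def)
  qed
  have "Hausdorff_space T"
    unfolding Hausdorff_space_def
  proof (intro allI impI)
    fix x y assume xy: "x \<in> topspace T \<and> y \<in> topspace T \<and> x \<noteq> y"
    show "\<exists>U V. openin T U \<and> openin T V \<and> x \<in> U \<and> y \<in> V \<and> disjnt U V"
    proof (cases x)
      case Zero
      with xy sep show ?thesis by (cases y) auto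
    next
      case (In0 a)
      show ?thesis
      proof (cases y)
        case Zero
        with In0 sep[of a] show ?thesis by (metis disjnt_sym)
      next
        case (In0 b)
        with xy \<open>x = In0 a\<close> show ?thesis
          using open_nz[of "{In0 a}"] open_nz[of "{In0 b}"] by (metis disjnt_insert1 disjnt_empty1 singleton_iff singletonI zero_ext.distinct(1))
      qed
    qed
  qed
  with zc cont topT have "closedin T (range In0)"
    by (auto simp: zero_closed_def semigroup_topology_def)
  then have "op (UNIV - range In0)" by (simp add: closedin_def topT openT)
  moreover have "Zero \<in> UNIV - range In0" by auto
  ultimately obtain i where "In0 ` V i \<subseteq> UNIV - range In0" unfolding op_def by blast
  with ne[of i] show False by blast
qed

section \<open>Covers by fewer than continuum many algebraic sets\<close>

lemma countable_less_continuum: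
  assumes "countable A"
  shows "|A| <o |UNIV :: real set|"
proof -
  have "\<not> |UNIV :: real set| \<le>o |A|"
  proof
    assume "|UNIV :: real set| \<le>o |A|"
    then obtain f :: "real \<Rightarrow> 'a" where "inj_on f UNIV" "f ` UNIV \<subseteq> A"
      unfolding card_of_ordLeq[symmetric] by blast
    with assms show False
      using countable_subset countable_image_inj_on uncountable_UNIV_real by blast
  qed
  then show ?thesis
    by (simp add: not_ordLeq_iff_ordLess card_of_Well_order)
qed

lemma lists_less_continuum:
  assumes "|A| <o |UNIV :: real set|"
  shows "|lists A| <o |UNIV :: real set|"
proof (cases "countable A")
  case True
  then show ?thesis by (intro countable_less_continuum countable_lists)
next
  case False
  then have inf: "infinite A" by (auto simp: countable_finite)
  have "|{xs \<in> lists A. length xs = n}| \<le>o |A|" for n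
  proof (induction n)
    case 0
    have "{xs \<in> lists A. length xs = 0} = {[]}" by auto
    moreover have "|{[] :: 'a list}| \<le>o |A|"
      using inf by (intro card_of_singl_ordLeq) auto
    ultimately show ?case by simp
  next
    case (Suc n)
    have "{xs \<in> lists A. length xs = Suc n} \<subseteq> (\<lambda>(x, xs). x # xs) ` (A \<times> {xs \<in> lists A. length xs = n})"
      by (auto simp: length_Suc_conv)
    then have "|{xs \<in> lists A. length xs = Suc n}| \<le>o |A \<times> {xs \<in> lists A. length xs = n}|"
      by (meson card_of_image card_of_mono1 ordLeq_transitive)
    also have "|A \<times> {xs \<in> lists A. length xs = n}| \<le>o |A|"
    proof -
      have "Field |A| = A" "Card_order |A|" by (rule Field_card_of card_of_Card_order)+
      then show ?thesis
        using card_of_Times_ordLeq_infinite_Field[of "|A|" A "{xs \<in> lists A. length xs = n}"] inf Suc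
        by (simp add: card_of_refl ordIso_imp_ordLeq)
    qed
    finally show ?case .
  qed
  moreover have "|UNIV :: nat set| \<le>o |A|" using inf by (simp add: infinite_iff_card_of_nat)
  ultimately have "|\<Union>n. {xs \<in> lists A. length xs = n}| \<le>o |A|"
    using inf by (intro card_of_UNION_ordLeq_infinite) auto
  moreover have "(\<Union>n. {xs \<in> lists A. length xs = n}) = lists A" by auto
  ultimately show ?thesis using assms ordLeq_ordLess_trans by metis
qed

lemma words_less_continuum:
  assumes "|L| <o |UNIV :: real set|"
  shows "|words L| <o |UNIV :: real set|"
proof -
  have "|Some ` L| <o |UNIV :: real set|"
    using assms card_of_image ordLeq_ordLess_trans by blast
  moreover have "|{None :: 'a option}| <o |UNIV :: real set|"
    by (intro countable_less_continuum) simp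
  ultimately have "|{None} \<union> Some ` L| <o |UNIV :: real set|"
    by (intro card_of_Un_ordLess_infinite) (auto simp: infinite_UNIV_char_0)
  from lists_less_continuum[OF this] have "|lists (insert None (Some ` L))| <o |UNIV :: real set|"
    by simp
  moreover have "words L \<subseteq> lists (insert None (Some ` L))"
    by (auto simp: words_def)
  ultimately show ?thesis using card_of_mono1 ordLeq_ordLess_trans by blast
qed

text \<open>Suppose that no such \<open>L\<close> exists. Along a well-order of the reals of least type, choose \<open>x k\<close> so that
  no word over \<open>L x k\<close>, the set of all earlier \<open>g j\<close> and \<open>x j\<close>, takes at \<open>x k\<close> a value congruent to a
  member of \<open>L x k\<close>; this set is smaller than the continuum. Every element of the semigroup is
  congruent to a constant that is available from some stage on. Hence the values
  \<open>weval w (x k)\<close> with \<open>k\<close> beyond \<open>i\<close> absorb translations as \<open>i\<close> grows, and they finally avoid each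
  element.\<close>

lemma zero_closed_small_cover:
  fixes E :: "'a::semigroup_mult \<Rightarrow> 'a \<Rightarrow> bool" and g :: "real \<Rightarrow> 'a"
  assumes zc: "zero_closed TYPE('a)"
    and E: "equivp E" "\<And>a b c d. E a b \<Longrightarrow> E c d \<Longrightarrow> E (a * c) (b * d)"
    and g: "\<And>x. \<exists>t. E x (g t)"
  obtains L where "|L| <o |UNIV :: real set|" "\<And>x. \<exists>w\<in>words L. \<exists>b\<in>L. E (weval w x) b"
proof (rule ccontr)
  assume "\<not> thesis"
  with that have N: "\<exists>x. \<forall>w\<in>words L. \<forall>b\<in>L. \<not> E (weval w x) b" if "|L| <o |UNIV :: real set|" for L
    using that by meson
  have Erefl: "E a a" and Esym: "E a b \<Longrightarrow> E b a" and Etrans: "E a b \<Longrightarrow> E b c \<Longrightarrow> E a c" for a b c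
    using E(1) by (auto elim: equivpE dest: reflpD sympD transpD)
  define r where "r = |UNIV :: real set|"
  have r: "Card_order r" "Well_order r" "Field r = UNIV"
    unfolding r_def by (rule card_of_Card_order card_of_Well_order Field_card_of)+
  then have lin: "linear_order_on UNIV r" and wf: "wf (r - Id)"
    by (auto simp: well_order_on_def)
  then have refl: "(a, a) \<in> r" and trans: "(a, b) \<in> r \<Longrightarrow> (b, c) \<in> r \<Longrightarrow> (a, c) \<in> r"
    and antisym: "(a, b) \<in> r \<Longrightarrow> (b, a) \<in> r \<Longrightarrow> a = b" and total: "(a, b) \<in> r \<or> (b, a) \<in> r" for a b c
    by (auto simp: order_on_defs refl_on_def dest: transD antisymD) (metis UNIV_I total_on_def)
  have lim: "\<exists>b. (a, b) \<in> r \<and> a \<noteq> b" for a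
    using infinite_Card_order_limit[OF r(1), of a] r(3) by (auto simp: infinite_UNIV_char_0)
  define L where "L x k = g ` underS r k \<union> x ` underS r k" for x k
  have small: "|L x k| <o |UNIV :: real set|" for x k
  proof -
    have "|underS r k| <o |UNIV :: real set|"
      using card_of_underS[OF r(1), of k] r(3) by (simp add: r_def)
    then have "|h ` underS r k| <o |UNIV :: real set|" for h :: "real \<Rightarrow> 'a"
      using card_of_image ordLeq_ordLess_trans by blast
    then show ?thesis
      unfolding L_def by (intro card_of_Un_ordLess_infinite) (auto simp: infinite_UNIV_char_0)
  qed
  have "\<exists>x. \<forall>k. \<forall>w\<in>words (L x k). \<forall>b\<in>L x k. \<not> E (weval w (x k)) b"
  proof (rule dependent_wf_choice[OF wf])
    fix f f' :: "real \<Rightarrow> 'a" and k y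
    assume "\<And>z. (z, k) \<in> r - Id \<Longrightarrow> f z = f' z"
    then have "L f k = L f' k"
      unfolding L_def underS_def by (intro arg_cong2[where f = "(\<union>)"] image_cong) auto
    then show "(\<forall>w\<in>words (L f k). \<forall>b\<in>L f k. \<not> E (weval w y) b) =
               (\<forall>w\<in>words (L f' k). \<forall>b\<in>L f' k. \<not> E (weval w y) b)" by simp
  qed (use N small in blast)
  then obtain x where x: "\<And>k w b. w \<in> words (L x k) \<Longrightarrow> b \<in> L x k \<Longrightarrow> \<not> E (weval w (x k)) b"
    by blast
  have L_step: "insert (x k) (L x k) \<subseteq> L x l" if "(k, l) \<in> r" "k \<noteq> l" for k l
  proof -
    have "insert k (underS r k) \<subseteq> underS r l"
      unfolding underS_def using that trans antisym by blast
    then show ?thesis unfolding L_def by blast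
  qed
  have L_mono: "L x k \<subseteq> L x l" if "(k, l) \<in> r" for k l
    using L_step[OF that] by blast
  define V where "V i = {y. \<exists>k. (i, k) \<in> r \<and> (\<exists>w\<in>words (L x k). E y (weval w (x k)))}" for i
  have VI: "y \<in> V i" if "(i, k) \<in> r" "w \<in> words (L x k)" "E y (weval w (x k))" for y i k w
    using that V_def by blast
  have V_mono: "V j \<subseteq> V i" if "(i, j) \<in> r" for i j
    using that trans V_def by blast
  \<comment> \<open>Each \<open>a\<close> is congruent to a constant \<open>s\<close> that may be used at all stages from \<open>j\<close> on.\<close>
  have letter: "\<exists>j s. (i, j) \<in> r \<and> E a s \<and> (\<forall>k. (j, k) \<in> r \<longrightarrow> s \<in> L x k)" for a i
  proof -
    obtain t where t: "E a (g t)" using g by blast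
    obtain j where j: "(i, j) \<in> r" "(t, j) \<in> r" "t \<noteq> j"
      using lim total trans antisym by metis
    have "g t \<in> L x k" if "(j, k) \<in> r" for k
      using j that trans antisym unfolding L_def underS_def by blast
    with t j show ?thesis by blast
  qed
  obtain b where "\<And>i. b \<in> V i"
  proof (rule zero_closed_no_filter[OF zc, of V])
    fix i
    have "[None] \<in> words (L x i)" by (simp add: words_def)
    from VI[OF refl this, of "x i"] show "V i \<noteq> {}" using Erefl by auto
    fix j
    show "\<exists>k. V k \<subseteq> V i \<inter> V j" using V_mono total refl by (meson Int_greatest)
  next
    fix i
    have "y * y' \<in> V i" if "y \<in> V i" "y' \<in> V i" for y y'
    proof -
      obtain k v where k: "(i, k) \<in> r" "v \<in> words (L x k)" "E y (weval v (x k))"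
        using \<open>y \<in> V i\<close> V_def by blast
      obtain l w where l: "(i, l) \<in> r" "w \<in> words (L x l)" "E y' (weval w (x l))"
        using \<open>y' \<in> V i\<close> V_def by blast
      have Em: "E (y * y') (weval v (x k) * weval w (x l))" by (intro E(2) k l)
      show ?thesis
      proof (cases "(k, l) \<in> r")
        case True
        then have "x k = x l \<and> L x k = L x l \<or> insert (x k) (L x k) \<subseteq> L x l" using L_step by blast
        from words_mult(1)[OF k(2) l(2) this] Em show ?thesis using VI[OF l(1)] by metis
      next
        case False
        then have "x l = x k \<and> L x l = L x k \<or> insert (x l) (L x l) \<subseteq> L x k" using L_step total by blast
        from words_mult(2)[OF l(2) k(2) this] Em show ?thesis using VI[OF k(1)] by metis
      qed
    qed
    then show "\<exists>j. \<forall>x\<in>V j. \<forall>y\<in>V j. x * y \<in> V i" by blast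
  next
    fix i a
    obtain j s where j: "(i, j) \<in> r" "E a s" "\<And>k. (j, k) \<in> r \<Longrightarrow> s \<in> L x k"
      using letter by blast
    have "a * y \<in> V i \<and> y * a \<in> V i" if "y \<in> V j" for y
    proof -
      obtain k v where k: "(j, k) \<in> r" "v \<in> words (L x k)" "E y (weval v (x k))"
        using \<open>y \<in> V j\<close> V_def by blast
      have s: "set [Some s] \<subseteq> insert None (Some ` L x k)" using j(3)[OF k(1)] by auto
      have v: "v \<noteq> []" using k(2) words_ne by blast
      show ?thesis
        using VI[OF trans[OF j(1) k(1)] words_append(2)[OF k(2) s], of "a * y"]
          VI[OF trans[OF j(1) k(1)] words_append(1)[OF k(2) s], of "y * a"] E(2) j(2) k(3) v
        by (simp add: weval_append weval_Cons)
    qed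
    then show "\<exists>j. \<forall>x\<in>V j. a * x \<in> V i" "\<exists>j. \<forall>x\<in>V j. x * a \<in> V i" by blast+
  qed blast
  moreover obtain j s where "E b s" "\<And>k. (j, k) \<in> r \<Longrightarrow> s \<in> L x k" using letter by blast
  ultimately obtain k w where "(j, k) \<in> r" "w \<in> words (L x k)" "E b (weval w (x k))"
    using V_def by blast
  moreover from this have "s \<in> L x k" using \<open>\<And>k. (j, k) \<in> r \<Longrightarrow> s \<in> L x k\<close> by blast
  ultimately show False using x \<open>E b s\<close> Esym Etrans by blast
qed

section \<open>Transfer of category from the real line\<close>

lemma floor_pow2_div: "\<lfloor>2 ^ (n + i) * t\<rfloor> div 2 ^ i = \<lfloor>2 ^ n * t\<rfloor>" for t :: real
  using floor_divide_real_eq_div[of "2 ^ i" "2 ^ (n + i) * t"] by (simp add: power_add field_simps)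

text \<open>Pseudometrics stand for the metric quotients in which distance \<open>0\<close> becomes equality. Arguing with
  them on \<open>X\<close> itself, a single semigroup is considered throughout.\<close>

locale pseudometric =
  fixes d :: "'a \<Rightarrow> 'a \<Rightarrow> real"
  assumes zero [simp]: "d x x = 0"
    and commute: "d x y = d y x"
    and triangle: "d x z \<le> d x y + d y z"
begin

lemma nonneg [simp]: "0 \<le> d x y"
  using triangle[of x x y] commute[of x y] by simp

definition complete_on :: "'a set \<Rightarrow> bool" where
  "complete_on Z \<longleftrightarrow> (\<forall>\<sigma> :: nat \<Rightarrow> 'a. range \<sigma> \<subseteq> Z \<longrightarrow>
     (\<forall>\<epsilon>>0. \<exists>N. \<forall>m\<ge>N. \<forall>n\<ge>N. d (\<sigma> m) (\<sigma> n) < \<epsilon>) \<longrightarrow>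
     (\<exists>z\<in>Z. \<forall>\<epsilon>>0. \<exists>N. \<forall>n\<ge>N. d (\<sigma> n) z < \<epsilon>))"

definition dense_seq_on :: "'a set \<Rightarrow> (nat \<Rightarrow> 'a) \<Rightarrow> bool" where
  "dense_seq_on Z p \<longleftrightarrow> range p \<subseteq> Z \<and> (\<forall>z\<in>Z. \<forall>\<epsilon>>0. \<exists>n. d (p n) z < \<epsilon>)"

lemma dense_seq_on_subset:
  assumes q: "dense_seq_on UNIV q" and "Z \<noteq> {}"
  obtains p where "dense_seq_on Z p"
proof -
  obtain z0 where z0: "z0 \<in> Z" using assms(2) by blast
  define near where "near i m z \<longleftrightarrow> z \<in> Z \<and> d (q i) z < 1 / real (Suc m)" for i m z
  define p where "p n = (case prod_decode n of (i, m) \<Rightarrow>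
    if \<exists>z. near i m z then (SOME z. near i m z) else z0)" for n
  have "p n \<in> Z" for n
    using z0 by (auto simp: p_def split: prod.splits) (metis (mono_tags, lifting) near_def someI_ex)
  moreover have "\<exists>n. d (p n) z < \<epsilon>" if z: "z \<in> Z" and \<epsilon>: "\<epsilon> > 0" for z \<epsilon>
  proof -
    obtain m where m: "1 / real (Suc m) < \<epsilon> / 2"
      using nat_approx_posE[of "\<epsilon> / 2"] \<epsilon> by auto
    obtain i where i: "d (q i) z < 1 / real (Suc m)"
      using q unfolding dense_seq_on_def by (metis UNIV_I of_nat_0_less_iff zero_less_Suc zero_less_divide_1_iff)
    have "near i m z" using i z by (simp add: near_def)
    then have "near i m (SOME z. near i m z)" by (rule someI)
    moreover have "p (prod_encode (i, m)) = (SOME z. near i m z)"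
      using \<open>near i m z\<close> by (auto simp: p_def)
    ultimately have "d (q i) (p (prod_encode (i, m))) < 1 / real (Suc m)"
      by (simp add: near_def[symmetric]) (simp add: near_def)
    then have "d (p (prod_encode (i, m))) z < \<epsilon>"
      using i m triangle[of "p (prod_encode (i, m))" z "q i"] commute[of "q i" "p (prod_encode (i, m))"]
      by linarith
    then show ?thesis by blast
  qed
  ultimately show thesis using that unfolding dense_seq_on_def by blast
qed

text \<open>The binary digits of a real number are read as instructions for shrinking a ball of \<open>Z\<close> with centre
  in the dense sequence: digit \<open>0\<close> moves to the next candidate ball, digit \<open>1\<close> accepts the current
  candidate if it is a much smaller ball inside the present one. The centres form a Cauchy sequence
  whose limit is the value of \<open>\<phi>\<close>, for every real number. After finitely many digits only a ball is
  decided, and suitable further digits lead into any smaller ball; so if \<open>N\<close> is nowhere dense in \<open>Z\<close>,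
  every interval has a subinterval that \<open>\<phi>\<close> maps outside \<open>N\<close>.\<close>

lemma category_map:
  assumes Z: "complete_on Z" and p: "dense_seq_on Z p"
  obtains \<phi> :: "real \<Rightarrow> 'a" where "range \<phi> \<subseteq> Z"
    "\<And>N. (\<And>z \<epsilon>. z \<in> Z \<Longrightarrow> \<epsilon> > 0 \<Longrightarrow>
              \<exists>z'\<in>Z. d z z' < \<epsilon> \<and> (\<exists>\<delta>>0. \<forall>x\<in>Z. d z' x < \<delta> \<longrightarrow> x \<notin> N)) \<Longrightarrow>
          nowhere_dense (\<phi> -` N)"
proof -
  \<comment> \<open>A state \<open>(j, l, m)\<close> is the ball with centre \<open>p j\<close> and radius \<open>(1/2) ^ l\<close> with a counter \<open>m\<close>; the
    candidate is coded in the first component of \<open>m\<close>, so that each candidate recurs for ever.\<close>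
  define step where "step b s = (case s of (j, l, m) \<Rightarrow>
      case prod_decode (fst (prod_decode m)) of (j', l') \<Rightarrow>
      if b \<and> l + 2 \<le> l' \<and> d (p j) (p j') < (1/2) ^ (l + 1) then (j', l', 0) else (j, l, Suc m))"
    for b and s :: "nat \<times> nat \<times> nat"
  define st where "st x = rec_nat (0, 0, 0) (\<lambda>n. step (odd \<lfloor>2 ^ Suc n * x\<rfloor>))" for x :: real
  have st_0: "st x 0 = (0, 0, 0)" and st_Suc: "st x (Suc n) = step (odd \<lfloor>2 ^ Suc n * x\<rfloor>) (st x n)" for x n
    by (simp_all add: st_def)
  define c where "c x n = p (fst (st x n))" for x n
  define \<rho> where "\<rho> x n = (1/2 :: real) ^ fst (snd (st x n))" for x n
  \<comment> \<open>Radii shrink at least as fast as centres move, so the sequence of centres is Cauchy whether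
    finitely or infinitely many balls are accepted.\<close>
  have c1: "d (c x n) (c x (Suc n)) \<le> \<rho> x n - \<rho> x (Suc n)" for x n
  proof -
    obtain j l m where s: "st x n = (j, l, m)" by (metis prod_cases3)
    obtain j' l' where dec: "prod_decode (fst (prod_decode m)) = (j', l')" by fastforce
    show ?thesis
    proof (cases "odd \<lfloor>2 ^ Suc n * x\<rfloor> \<and> l + 2 \<le> l' \<and> d (p j) (p j') < (1/2) ^ (l + 1)")
      case True
      then have s': "st x (Suc n) = (j', l', 0)"
        unfolding st_Suc s by (simp add: step_def dec)
      have "(1/2 :: real) ^ l' \<le> (1/2) ^ (l + 2)"
        using True by (intro power_decreasing) auto
      moreover have "d (p j) (p j') * 2 < (1/2) ^ l" using True by simp
      moreover have "0 \<le> (1/2 :: real) ^ l" by simp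
      ultimately have "d (p j) (p j') \<le> (1/2) ^ l - (1/2) ^ l'"
        unfolding power_add power2_eq_square by linarith
      then show ?thesis using s s' by (simp add: c_def \<rho>_def)
    next
      case False
      then have "st x (Suc n) = (j, l, Suc m)"
        unfolding st_Suc s by (auto simp: step_def dec)
      then show ?thesis using s by (simp add: c_def \<rho>_def)
    qed
  qed
  have c2: "d (c x n) (c x (n + k)) \<le> \<rho> x n - \<rho> x (n + k)" for x n k
  proof (induction k)
    case (Suc k)
    then show ?case
      using c1[of x "n + k"] triangle[of "c x n" "c x (n + Suc k)" "c x (n + k)"] by simp
  qed simp
  have \<rho>pos: "\<rho> x n > 0" for x n by (simp add: \<rho>_def)
  have lim: "\<exists>z\<in>Z. \<forall>\<epsilon>>0. \<exists>N. \<forall>n\<ge>N. d (c x n) z < \<epsilon>" for x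
  proof -
    have "range (c x) \<subseteq> Z" using p by (auto simp: c_def dense_seq_on_def)
    moreover have "\<exists>N. \<forall>m\<ge>N. \<forall>n\<ge>N. d (c x m) (c x n) < \<epsilon>" if "\<epsilon> > 0" for \<epsilon>
    proof -
      have "decseq (\<rho> x)"
        using c2[of x] nonneg by (intro decseq_SucI) (metis add_0_right c1 diff_ge_0_iff_ge order_trans)
      then have "convergent (\<rho> x)"
        using \<rho>pos by (intro Bseq_monoseq_convergent decseq_imp_monoseq decseq_bounded[of _ 0])
          (auto intro: less_imp_le)
      then have "Cauchy (\<rho> x)" by (rule convergent_Cauchy)
      then obtain N where N: "\<And>m n. m \<ge> N \<Longrightarrow> n \<ge> N \<Longrightarrow> norm (\<rho> x m - \<rho> x n) < \<epsilon>"
        using CauchyD \<open>\<epsilon> > 0\<close> by blast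
      have "d (c x m) (c x n) < \<epsilon>" if "m \<ge> N" "n \<ge> N" for m n
      proof (cases "m \<le> n")
        case True
        then show ?thesis using c2[of x m "n - m"] N[OF that] by simp
      next
        case False
        then show ?thesis using c2[of x n "m - n"] N[OF that] commute[of "c x m"] by simp
      qed
      then show ?thesis by blast
    qed
    ultimately show ?thesis using Z unfolding complete_on_def by blast
  qed
  then obtain \<phi> where \<phi>: "\<And>x. \<phi> x \<in> Z" "\<And>x \<epsilon>. \<epsilon> > 0 \<Longrightarrow> \<exists>N. \<forall>n\<ge>N. d (c x n) (\<phi> x) < \<epsilon>"
    by metis
  have \<phi>_near: "d (c x n) (\<phi> x) \<le> \<rho> x n" for x n
  proof (rule field_le_epsilon)
    fix \<epsilon> :: real assume "\<epsilon> > 0"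
    then obtain N where N: "\<forall>k\<ge>N. d (c x k) (\<phi> x) < \<epsilon>" using \<phi>(2) by blast
    show "d (c x n) (\<phi> x) \<le> \<rho> x n + \<epsilon>"
      using N[rule_format, of "n + N"] c2[of x n N] \<rho>pos[of x "n + N"]
        triangle[of "c x n" "\<phi> x" "c x (n + N)"] by simp
  qed
  have st_cell: "st x n = st y n" if "\<lfloor>2 ^ n * x\<rfloor> = \<lfloor>2 ^ n * y\<rfloor>" for x y n
    using that
  proof (induction n)
    case (Suc n)
    have "\<lfloor>2 ^ n * x\<rfloor> = \<lfloor>2 ^ n * y\<rfloor>"
      using Suc.prems floor_pow2_div[of n 1] by (metis One_nat_def add_Suc_right add_0_right)
    with Suc show ?case by (simp add: st_Suc)
  qed (simp add: st_0)
  have "nowhere_dense (\<phi> -` N)"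
    if N: "\<And>z \<epsilon>. z \<in> Z \<Longrightarrow> \<epsilon> > 0 \<Longrightarrow>
              \<exists>z'\<in>Z. d z z' < \<epsilon> \<and> (\<exists>\<delta>>0. \<forall>x\<in>Z. d z' x < \<delta> \<longrightarrow> x \<notin> N)" for N
    unfolding nowhere_dense_def
  proof (rule ccontr)
    assume "interior (closure (\<phi> -` N)) \<noteq> {}"
    then obtain x0 e where e: "e > 0" "ball x0 e \<subseteq> closure (\<phi> -` N)"
      using mem_interior by blast
    obtain n where n: "(1/2 :: real) ^ n < e"
      using real_arch_pow_inv[of e "1/2"] e(1) by auto
    define k where "k = \<lfloor>2 ^ n * x0\<rfloor>"
    obtain j l m where s: "st x0 n = (j, l, m)" by (metis prod_cases3)
    have "p j \<in> Z" using p by (auto simp: dense_seq_on_def)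
    from N[OF this, of "(1/2) ^ (l + 2)"] obtain z' \<delta>
      where z': "z' \<in> Z" "d (p j) z' < (1/2) ^ (l + 2)" "\<delta> > 0" "\<forall>x\<in>Z. d z' x < \<delta> \<longrightarrow> x \<notin> N"
      by auto
    obtain l0 where l0: "(1/2 :: real) ^ l0 < \<delta> / 2"
      using real_arch_pow_inv[of "\<delta> / 2" "1/2"] z'(3) by auto
    define l' where "l' = max l0 (l + 2)"
    have "(1/2 :: real) ^ l' \<le> (1/2) ^ l0" "(1/2 :: real) ^ l' \<le> (1/2) ^ (l + 2)" "l + 2 \<le> l'"
      unfolding l'_def by (intro power_decreasing; simp)+ simp
    then have l': "(1/2 :: real) ^ l' < \<delta> / 2" "(1/2 :: real) ^ l' \<le> (1/2) ^ (l + 2)" "l + 2 \<le> l'"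
      using l0 by linarith+
    obtain j' where j': "d (p j') z' < (1/2) ^ l'"
      using p z'(1) unfolding dense_seq_on_def by (metis half_gt_zero_iff zero_less_numeral zero_less_one zero_less_power)
    have jj': "d (p j) (p j') < (1/2) ^ (l + 1)"
      using triangle[of "p j" "p j'" z'] commute[of z' "p j'"] z'(2) j' l'(2) by simp
    \<comment> \<open>The counter value \<open>M\<close> codes the wanted ball \<open>(j', l')\<close> and is not yet passed, as \<open>m \<le> M\<close>.
      After \<open>i\<close> digits \<open>0\<close> and one digit \<open>1\<close> this ball is accepted.\<close>
    define M where "M = prod_encode (prod_encode (j', l'), m)"
    define i where "i = M - m"
    have Mi: "m + i = M" using le_prod_encode_2[of m "prod_encode (j', l')"] by (simp add: M_def i_def)
    define K where "K = 2 * (k * 2 ^ i) + 1"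
    define J where "J = {real_of_int K / 2 ^ (n + Suc i)<..<real_of_int (K + 1) / 2 ^ (n + Suc i)}"
    have fl: "\<lfloor>2 ^ (n + Suc i) * t\<rfloor> = K" if "t \<in> J" for t
    proof -
      have "real_of_int K < 2 ^ (n + Suc i) * t" "2 ^ (n + Suc i) * t < real_of_int K + 1"
        using that by (simp_all add: J_def divide_less_eq less_divide_eq mult.commute)
      then show ?thesis by linarith
    qed
    have fl': "\<lfloor>2 ^ (n + i') * t\<rfloor> = k * 2 ^ i'" if t: "t \<in> J" and "i' \<le> i" for t i'
    proof -
      have "\<lfloor>2 ^ (n + i) * t\<rfloor> = K div 2"
        using fl[OF t] floor_pow2_div[of "n + i" 1 t] by simp
      then have "\<lfloor>2 ^ (n + i) * t\<rfloor> = k * 2 ^ i" by (simp add: K_def)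
      moreover have "\<lfloor>2 ^ (n + i) * t\<rfloor> div 2 ^ (i - i') = \<lfloor>2 ^ (n + i') * t\<rfloor>"
        using floor_pow2_div[of "n + i'" "i - i'" t] \<open>i' \<le> i\<close> by simp
      moreover have "(2 :: int) ^ i = 2 ^ i' * 2 ^ (i - i')"
        using \<open>i' \<le> i\<close> by (simp flip: power_add)
      ultimately show ?thesis by simp
    qed
    have stt: "st t (n + i') = (j, l, m + i')" if t: "t \<in> J" and "i' \<le> i" for t i'
      using \<open>i' \<le> i\<close>
    proof (induction i')
      case 0
      have "\<lfloor>2 ^ n * t\<rfloor> = \<lfloor>2 ^ n * x0\<rfloor>" using fl'[OF t, of 0] by (simp add: k_def)
      then show ?case using st_cell[of n t x0] s by simp
    next
      case (Suc i')
      have "even \<lfloor>2 ^ Suc (n + i') * t\<rfloor>" using fl'[OF t Suc.prems] by simp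
      then have "st t (Suc (n + i')) = (j, l, Suc (m + i'))"
        unfolding st_Suc using Suc by (simp add: step_def split: prod.split)
      then show ?case by simp
    qed
    have out: "\<phi> t \<notin> N" if t: "t \<in> J" for t
    proof -
      have "odd \<lfloor>2 ^ Suc (n + i) * t\<rfloor>" using fl[OF t] by (simp add: K_def)
      then have "st t (Suc (n + i)) = (j', l', 0)"
        unfolding st_Suc using stt[OF t, of i] l'(3) jj' Mi by (simp add: step_def M_def)
      then have "d (p j') (\<phi> t) \<le> (1/2) ^ l'"
        using \<phi>_near[of t "Suc (n + i)"] by (simp add: c_def \<rho>_def)
      then have "d z' (\<phi> t) < \<delta>"
        using triangle[of z' "\<phi> t" "p j'"] commute[of z' "p j'"] j' l'(1) by linarith
      then show ?thesis using z'(4) \<phi>(1) by blast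
    qed
    have "J \<subseteq> ball x0 e"
    proof
      fix t assume "t \<in> J"
      from fl'[OF this, of 0] have "\<lfloor>2 ^ n * t\<rfloor> = \<lfloor>2 ^ n * x0\<rfloor>" by (simp add: k_def)
      then have "\<bar>2 ^ n * x0 - 2 ^ n * t\<bar> < 1" by linarith
      then have "2 ^ n * \<bar>x0 - t\<bar> < 1"
        by (simp add: abs_mult flip: right_diff_distrib)
      then have "\<bar>x0 - t\<bar> < (1/2) ^ n"
        by (simp add: power_one_over field_simps)
      then show "t \<in> ball x0 e" using n by (simp add: dist_real_def)
    qed
    moreover have "open J" by (simp add: J_def)
    moreover have "J \<noteq> {}"
    proof -
      have "real_of_int K / 2 ^ (n + Suc i) < real_of_int (K + 1) / 2 ^ (n + Suc i)"
        by (rule divide_strict_right_mono) simp_all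
      then show ?thesis unfolding J_def greaterThanLessThan_empty_iff not_le .
    qed
    ultimately have "J \<inter> \<phi> -` N \<noteq> {}"
      using e(2) by (metis (no_types, opaque_lifting) inf.absorb_iff1 inf_bot_right open_Int_closure_eq_empty order_trans)
    with out show False by blast
  qed
  with \<phi>(1) that show thesis by blast
qed

end

section \<open>Subinvariant pseudometrics\<close>

locale subinvariant_pseudometric = pseudometric d
  for d :: "'a::semigroup_mult \<Rightarrow> 'a \<Rightarrow> real" +
  assumes left: "d (a * x) (a * y) \<le> d x y"
    and right: "d (x * a) (y * a) \<le> d x y"
begin

lemma mult_le: "d (x * y) (x' * y') \<le> d x x' + d y y'"
  using triangle[of "x * y" "x' * y'" "x' * y"] right[of x y x'] left[of x' y y'] by linarith

lemma weval_Lipschitz: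
  assumes "w \<noteq> []"
  shows "d (weval w x) (weval w y) \<le> length w * d x y"
  using assms
proof (induction w rule: weval_induct)
  case (letter l)
  then show ?case by (cases l) simp_all
next
  case (Cons l w)
  have "d (weval [l] x) (weval [l] y) \<le> d x y" by (cases l) simp_all
  then show ?case
    using Cons mult_le[of "weval [l] x" "weval w x" "weval [l] y" "weval w y"]
    by (simp add: weval_Cons[of w] algebra_simps)
qed

text \<open>Up to distance \<open>0\<close>, a point is determined by the countable set of rational balls around members of
  the dense sequence that contain it, and sets of natural numbers are enumerated by the reals.\<close>

lemma real_enumeration:
  assumes q: "dense_seq_on UNIV q"
  obtains g :: "real \<Rightarrow> 'a" where "\<And>x. \<exists>t. d x (g t) = 0"
proof -
  define A where "A x = {prod_encode (n, m) | n m. d (q n) x < 1 / real (Suc m)}" for x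
  obtain h :: "real \<Rightarrow> nat set" where h: "surj h"
    using nat_sets_eqpoll_reals unfolding eqpoll_def bij_betw_def
    by (metis bij_betw_def bij_betw_inv)
  have A: "d x y = 0" if "A x = A y" for x y
  proof (rule ccontr)
    assume "d x y \<noteq> 0"
    then have "d x y > 0" using nonneg[of x y] by linarith
    then obtain m where m: "1 / real (Suc m) < d x y / 2"
      using nat_approx_posE[of "d x y / 2"] by auto
    obtain n where n: "d (q n) x < 1 / real (Suc m)"
      using q unfolding dense_seq_on_def
      by (metis UNIV_I of_nat_0_less_iff zero_less_Suc zero_less_divide_1_iff)
    then have "prod_encode (n, m) \<in> A x" by (auto simp: A_def)
    then have "d (q n) y < 1 / real (Suc m)" unfolding \<open>A x = A y\<close> by (auto simp: A_def)
    then show False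
      using m n triangle[of x y "q n"] commute[of x "q n"] by linarith
  qed
  have "\<exists>t. d x (SOME y. A y = h t) = 0" for x
  proof -
    obtain t where "h t = A x" using h by (metis surjD)
    moreover have "A (SOME y. A y = A x) = A x" by (rule someI) simp
    ultimately show ?thesis using A by metis
  qed
  with that[of "\<lambda>t. SOME y. A y = h t"] show thesis by blast
qed

text \<open>By \<open>zero_closed_small_cover\<close> the semigroup is covered by fewer than continuum many sets
  \<open>{x. d (weval w x) b = 0}\<close>. If all of them were nowhere dense in \<open>Z\<close>, their preimages under
  \<open>category_map\<close> would cover the line by fewer than \<open>cov(M)\<close> meager sets.\<close>

lemma algebraic_set_with_interior:
  assumes cov: "cov_M =o |UNIV :: real set|"
    and zc: "zero_closed TYPE('a)"
    and q: "dense_seq_on UNIV q"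
    and Z: "complete_on Z" "Z \<noteq> {}"
  obtains w b z \<epsilon> where "None \<in> set w" "z \<in> Z" "\<epsilon> > 0"
    "\<And>x. x \<in> Z \<Longrightarrow> d z x < \<epsilon> \<Longrightarrow> d (weval w x) b = 0"
proof (rule ccontr)
  assume "\<not> thesis"
  with that have none: "\<exists>x\<in>Z. d z x < \<epsilon> \<and> d (weval w x) b \<noteq> 0"
    if "None \<in> set w" "z \<in> Z" "\<epsilon> > 0" for w b z \<epsilon>
    using that by metis
  obtain g :: "real \<Rightarrow> 'a" where g: "\<And>x. \<exists>t. d x (g t) = 0"
    using real_enumeration[OF q] by blast
  have "equivp (\<lambda>x y. d x y = 0)"
  proof (intro equivpI reflpI sympI transpI)
    fix x y z assume "d x y = 0" "d y z = 0"
    then show "d x z = 0" using triangle[of x z y] nonneg[of x z] by linarith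
  qed (simp_all add: commute)
  moreover have "d (x * y) (x' * y') = 0" if "d x x' = 0" "d y y' = 0" for x y x' y'
    using mult_le[of x y x' y'] nonneg[of "x * y" "x' * y'"] that by linarith
  ultimately obtain L where L: "|L| <o |UNIV :: real set|"
    "\<And>x. \<exists>w\<in>words L. \<exists>b\<in>L. d (weval w x) b = 0"
    using zero_closed_small_cover[OF zc, of "\<lambda>x y. d x y = 0" g] g by metis
  obtain p where p: "dense_seq_on Z p"
    using dense_seq_on_subset[OF q Z(2)] by blast
  obtain \<phi> :: "real \<Rightarrow> 'a" where \<phi>: "range \<phi> \<subseteq> Z"
    "\<And>N. (\<And>z \<epsilon>. z \<in> Z \<Longrightarrow> \<epsilon> > 0 \<Longrightarrow>
              \<exists>z'\<in>Z. d z z' < \<epsilon> \<and> (\<exists>\<delta>>0. \<forall>x\<in>Z. d z' x < \<delta> \<longrightarrow> x \<notin> N)) \<Longrightarrow>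
          nowhere_dense (\<phi> -` N)"
    using category_map[OF Z(1) p] by blast
  define A where "A w b = {x. d (weval w x) b = 0}" for w b
  have nd: "nowhere_dense (\<phi> -` A w b)" if w: "None \<in> set w" for w b
  proof (rule \<phi>(2))
    fix z and \<epsilon> :: real assume "z \<in> Z" "\<epsilon> > 0"
    from none[OF w this] obtain x where x: "x \<in> Z" "d z x < \<epsilon>" "d (weval w x) b \<noteq> 0" by metis
    define \<delta> where "\<delta> = d (weval w x) b / length w"
    have ne: "w \<noteq> []" using w by auto
    have "\<delta> > 0" using x(3) ne nonneg[of "weval w x" b] by (simp add: \<delta>_def less_le)
    moreover have "y \<notin> A w b" if "d x y < \<delta>" for y
    proof
      assume "y \<in> A w b"
      then have "d (weval w x) b \<le> length w * d x y"
        using triangle[of "weval w x" b "weval w y"] weval_Lipschitz[OF ne, of x y] by (simp add: A_def)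
      moreover have "length w * d x y < d (weval w x) b"
        using that ne by (simp add: \<delta>_def field_simps)
      ultimately show False by simp
    qed
    ultimately show "\<exists>z'\<in>Z. d z z' < \<epsilon> \<and> (\<exists>\<delta>>0. \<forall>x\<in>Z. d z' x < \<delta> \<longrightarrow> x \<notin> A w b)"
      using x by blast
  qed
  \<comment> \<open>A pair \<open>(w, b)\<close> is coded by the single word \<open>Some b # w\<close>, so that only words have to be counted.\<close>
  define \<G> where "\<G> = (\<lambda>u. \<phi> -` A (tl u) (the (hd u))) ` {u \<in> words L. tl u \<in> words L}"
  have "meager_cover \<G>"
    unfolding meager_cover_def
  proof
    show "\<forall>S\<in>\<G>. meager S"
    proof
      fix S assume "S \<in> \<G>"
      then have "nowhere_dense S" using nd by (auto simp: \<G>_def words_def)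
      then show "meager S" unfolding meager_def by (intro exI[of _ "{S}"]) simp
    qed
    show "\<Union>\<G> = UNIV"
    proof (rule UNIV_eq_I[symmetric])
      fix t
      obtain w b where wb: "w \<in> words L" "b \<in> L" "d (weval w (\<phi> t)) b = 0" using L(2) by blast
      then have "Some b # w \<in> {u \<in> words L. tl u \<in> words L}" by (auto simp: words_def)
      then have "\<phi> -` A w b \<in> \<G>" unfolding \<G>_def by (rule image_eqI[rotated]) simp
      moreover have "t \<in> \<phi> -` A w b" using wb by (simp add: A_def)
      ultimately show "t \<in> \<Union>\<G>" by blast
    qed
  qed
  then have "cov_M \<le>o |\<G>|" using cov_M by metis
  moreover have "|\<G>| <o |UNIV :: real set|"
  proof -
    have "|\<G>| \<le>o |{u \<in> words L. tl u \<in> words L}|" unfolding \<G>_def by (rule card_of_image)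
    also have "|{u \<in> words L. tl u \<in> words L}| \<le>o |words L|" by (rule card_of_mono1) auto
    finally show ?thesis using words_less_continuum[OF L(1)] ordLeq_ordLess_trans by blast
  qed
  ultimately show False
    using cov by (meson not_ordLess_ordLeq ordIso_ordLeq_trans ordIso_symmetric)
qed

text \<open>Assume that \<open>X\<close> is not polybounded. Then \<open>x k = z 0 * \<dots> * z k * y\<close> can be chosen so that short
  words over \<open>L x k\<close> take values outside \<open>U j\<close> for \<open>j \<le> k\<close>: otherwise finitely many polynomials would
  map every \<open>y\<close> into some \<open>U j\<close>, hence, as they also are polynomials in \<open>z j\<close>, into finitely many algebraic
  sets. The filter consists of the points within \<open>(1/2) ^ i\<close> of a value \<open>weval w (x k)\<close> with
  \<open>k \<ge> i\<close> and \<open>length w \<le> 2 ^ (k - i)\<close>. Both bounds are halved when \<open>i\<close> grows by one, which leaves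
  room for products, and for constants approximated by the dense sequence. A point \<open>b\<close> is
  moved by some polynomial \<open>w\<close> well inside some \<open>U j\<close>, so \<open>weval w b\<close> is finally outside the
  filter sets; and the filter absorbs \<open>w\<close>, so \<open>b\<close> itself is.\<close>

lemma polybounded_of_escape:
  fixes U :: "nat \<Rightarrow> 'a set"
  assumes zc: "zero_closed TYPE('a)"
    and q: "dense_seq_on UNIV q"
    and \<A>: "\<And>j. finite (\<A> j)" "\<And>j A. A \<in> \<A> j \<Longrightarrow> algebraic_subset A"
    and U: "\<And>j w. None \<in> set w \<Longrightarrow> weval w (z j) \<in> U j \<Longrightarrow> weval w (z j) \<in> \<Union>(\<A> j)"
    and reach: "\<And>b. \<exists>w j. \<exists>\<delta>>0. None \<in> set w \<and> (\<forall>y. d (weval w b) y < \<delta> \<longrightarrow> y \<in> U j)"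
  shows "polybounded TYPE('a)"
proof (rule ccontr)
  assume np: "\<not> polybounded TYPE('a)"
  have short: "finite {w \<in> words S. length w \<le> n}" if "finite S" for S :: "'a set" and n
  proof (rule finite_subset)
    show "{w \<in> words S. length w \<le> n} \<subseteq> {w. set w \<subseteq> insert None (Some ` S) \<and> length w \<le> n}"
      by (auto simp: words_def)
    show "finite {w. set w \<subseteq> insert None (Some ` S) \<and> length w \<le> n}"
      using that by (intro finite_lists_length_le) simp
  qed
  have choose: "\<exists>x. \<forall>w\<in>words S. length w \<le> n \<longrightarrow> (\<forall>j\<le>k. weval w x \<notin> U j)"
    if "finite S" for S n k
  proof (rule ccontr)
    assume "\<not> ?thesis"
    then have bad: "\<exists>w\<in>words S. length w \<le> n \<and> (\<exists>j\<le>k. weval w x \<in> U j)" for x by blast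
    \<comment> \<open>The word \<open>s\<close> is the product of \<open>z 0, \<dots>, z k\<close> and the variable.\<close>
    define s where "s = map (\<lambda>j. Some (z j)) [0..<Suc k] @ [None]"
    have s: "None \<in> set s" by (simp add: s_def)
    \<comment> \<open>A word in \<open>s\<close> contains the constant \<open>z j\<close>; exchanging the roles of \<open>z j\<close> and the variable makes
      it a polynomial in \<open>z j\<close>.\<close>
    have zs: "\<exists>u. None \<in> set u \<and> weval (wsubst s w) y = weval u (z j)"
      if "w \<in> words S" "j \<le> k" for w j y
    proof -
      have "wsubst s w \<noteq> []" "None \<in> set (wsubst s w)"
        using s words_ne that(1) None_in_wsubst[OF s, of w] by (auto simp: words_def)
      moreover have "Some (z j) \<in> set (wsubst s w)"
      proof -
        have "set s \<subseteq> set (wsubst s w)"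
          using that(1) by (auto simp: words_def wsubst_def intro!: bexI[of _ None])
        moreover have "Some (z j) \<in> set s" using that(2) unfolding s_def set_append set_map set_upt
          by (intro UnI1 imageI) simp
        ultimately show ?thesis by blast
      qed
      then obtain u v where uv: "wsubst s w = u @ Some (z j) # v" by (meson split_list)
      have "weval (wsubst s w) y = weval (plug y u @ None # plug y v) (z j)"
        unfolding uv by (simp add: weval_def plug_def comp_def)
      then show ?thesis by (intro exI[of _ "plug y u @ None # plug y v"]) simp
    qed
    define W where "W = {w \<in> words S. length w \<le> n}"
    define \<C> where "\<C> = {{y. weval (wsubst s w) y \<in> A} | w j A. w \<in> W \<and> j \<le> k \<and> A \<in> \<A> j}"
    have "\<C> = (\<lambda>(w, A). {y. weval (wsubst s w) y \<in> A}) ` (W \<times> (\<Union>j\<le>k. \<A> j))"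
      by (force simp: \<C>_def)
    then have "finite \<C>" using short[OF \<open>finite S\<close>] \<A>(1) by (simp add: W_def)
    moreover have "algebraic_subset C" if "C \<in> \<C>" for C
    proof -
      obtain w j A where C: "C = {y. weval (wsubst s w) y \<in> A}" "w \<in> W" "A \<in> \<A> j"
        using \<open>C \<in> \<C>\<close> by (auto simp: \<C>_def)
      have "None \<in> set (wsubst s w)" using C(2) None_in_wsubst[OF s] by (auto simp: W_def words_def)
      with algebraic_subset_preimage[OF \<A>(2)[OF C(3)]] C(1) show ?thesis by simp
    qed
    moreover have "y \<in> \<Union>\<C>" for y
    proof -
      obtain w j where w: "w \<in> words S" "length w \<le> n" "j \<le> k" "weval w (weval s y) \<in> U j"
        using bad by blast
      then have eq: "weval (wsubst s w) y = weval w (weval s y)"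
        using s words_ne by (intro weval_wsubst) auto
      with U zs[OF w(1,3)] w(4) have "weval (wsubst s w) y \<in> \<Union>(\<A> j)" by metis
      with w show ?thesis unfolding \<C>_def W_def by blast
    qed
    ultimately have "polybounded TYPE('a)"
      unfolding polybounded_def by (intro exI[of _ \<C>]) auto
    with np show False by simp
  qed
  define L where "L x k = q ` {..<k} \<union> x ` {..<k}" for x and k :: nat
  have "\<exists>x. \<forall>k. \<forall>w\<in>words (L x k). length w \<le> 2 ^ k \<longrightarrow> (\<forall>j\<le>k. weval w (x k) \<notin> U j)"
  proof (rule dependent_wellorder_choice)
    fix f f' :: "nat \<Rightarrow> 'a" and k y
    assume "\<And>i. i < k \<Longrightarrow> f i = f' i"
    then have "L f k = L f' k"
      unfolding L_def by (intro arg_cong2[where f = "(\<union>)"] image_cong) auto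
    then show "(\<forall>w\<in>words (L f k). length w \<le> 2 ^ k \<longrightarrow> (\<forall>j\<le>k. weval w y \<notin> U j)) =
               (\<forall>w\<in>words (L f' k). length w \<le> 2 ^ k \<longrightarrow> (\<forall>j\<le>k. weval w y \<notin> U j))" by simp
  qed (auto simp: L_def intro!: choose)
  then obtain x where x: "\<And>k w j. w \<in> words (L x k) \<Longrightarrow> length w \<le> 2 ^ k \<Longrightarrow> j \<le> k \<Longrightarrow> weval w (x k) \<notin> U j"
    by blast
  have L_step: "x k = x l \<and> L x k = L x l \<or> insert (x k) (L x k) \<subseteq> L x l" if "k \<le> l" for k l
    using that by (cases "k = l") (auto simp: L_def)
  define V where "V i = {y. \<exists>k\<ge>i. \<exists>w\<in>words (L x k). length w \<le> 2 ^ (k - i) \<and>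
      d y (weval w (x k)) < (1/2) ^ i}" for i
  have VI: "y \<in> V i" if "i \<le> k" "w \<in> words (L x k)" "length w \<le> 2 ^ (k - i)"
    "d y (weval w (x k)) < (1/2) ^ i" for y i k w
    using that V_def by blast
  have half_mono: "(1/2 :: real) ^ j \<le> (1/2) ^ i" if "i \<le> j" for i j :: nat
    using that by (intro power_decreasing) auto
  have V_mono: "V j \<subseteq> V i" if "i \<le> j" for i j
  proof
    fix y assume "y \<in> V j"
    then obtain k w where k: "j \<le> k" "w \<in> words (L x k)" "length w \<le> 2 ^ (k - j)"
      "d y (weval w (x k)) < (1/2) ^ j" using V_def by blast
    have "length w \<le> 2 ^ (k - i)"
      using k(3) \<open>i \<le> j\<close> by (meson diff_le_mono2 le_trans one_le_numeral power_increasing)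
    moreover have "d y (weval w (x k)) < (1/2) ^ i"
      using k(4) half_mono[OF \<open>i \<le> j\<close>] by linarith
    ultimately show "y \<in> V i" using VI k \<open>i \<le> j\<close> le_trans by blast
  qed
  have double: "2 ^ (k - Suc i) + 2 ^ (k - Suc i) \<le> (2 :: nat) ^ (k - i)" if "Suc i \<le> k" for k i
  proof -
    have "k - i = Suc (k - Suc i)" using that by simp
    then show ?thesis by simp
  qed
  have mult: "y * y' \<in> V i" if "y \<in> V (Suc i)" "y' \<in> V (Suc i)" for y y' i
  proof -
    obtain k v where k: "Suc i \<le> k" "v \<in> words (L x k)" "length v \<le> 2 ^ (k - Suc i)"
      "d y (weval v (x k)) < (1/2) ^ Suc i"
      using \<open>y \<in> V (Suc i)\<close> V_def by blast
    obtain l w where l: "Suc i \<le> l" "w \<in> words (L x l)" "length w \<le> 2 ^ (l - Suc i)"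
      "d y' (weval w (x l)) < (1/2) ^ Suc i"
      using \<open>y' \<in> V (Suc i)\<close> V_def by blast
    have dm: "d (y * y') (weval v (x k) * weval w (x l)) < (1/2) ^ i"
      using mult_le[of y y' "weval v (x k)" "weval w (x l)"] k(4) l(4) by simp
    have len: "length v + length w \<le> 2 ^ (max k l - i)"
    proof -
      have "(2 :: nat) ^ (k - Suc i) \<le> 2 ^ (max k l - Suc i)" "(2 :: nat) ^ (l - Suc i) \<le> 2 ^ (max k l - Suc i)"
        by (intro power_increasing; simp)+
      then show ?thesis using double[of i "max k l"] k(1,3) l(3) by linarith
    qed
    show ?thesis
    proof (cases "k \<le> l")
      case True
      obtain u where "u \<in> words (L x l)" "length u = length v + length w"
        "weval u (x l) = weval v (x k) * weval w (x l)"
        using words_mult(1)[OF k(2) l(2) L_step[OF True]] by blast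
      then show ?thesis using VI[of i l u] dm len True l(1) by simp
    next
      case False
      then have "l \<le> k" by simp
      obtain u where "u \<in> words (L x k)" "length u = length w + length v"
        "weval u (x k) = weval v (x k) * weval w (x l)"
        using words_mult(2)[OF l(2) k(2) L_step[OF \<open>l \<le> k\<close>]] by blast
      then show ?thesis using VI[of i k u] dm len \<open>l \<le> k\<close> k(1) by (simp add: max_absorb1)
    qed
  qed
  have trans: "\<exists>j. \<forall>y\<in>V j. a * y \<in> V i \<and> y * a \<in> V i" for a i
  proof -
    obtain t where t: "d (q t) a < (1/2) ^ Suc i"
      using q unfolding dense_seq_on_def by (meson UNIV_I half_gt_zero_iff zero_less_one zero_less_power)
    define j where "j = Suc (max i t)"
    have "a * y \<in> V i \<and> y * a \<in> V i" if "y \<in> V j" for y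
    proof -
      obtain k v where k: "j \<le> k" "v \<in> words (L x k)" "length v \<le> 2 ^ (k - j)"
        "d y (weval v (x k)) < (1/2) ^ j"
        using \<open>y \<in> V j\<close> V_def by blast
      have "q t \<in> L x k" using k(1) by (auto simp: L_def j_def)
      then have s: "set [Some (q t)] \<subseteq> insert None (Some ` L x k)" by auto
      have v: "v \<noteq> []" using k(2) words_ne by blast
      have "Suc i \<le> j" "Suc i \<le> k" using k(1) by (auto simp: j_def)
      have "(2 :: nat) ^ (k - j) \<le> 2 ^ (k - Suc i)" using \<open>Suc i \<le> j\<close> by (intro power_increasing) auto
      moreover have "(1 :: nat) \<le> 2 ^ (k - Suc i)" by simp
      ultimately have len: "Suc (length v) \<le> 2 ^ (k - i)"
        using k(3) double[OF \<open>Suc i \<le> k\<close>] by linarith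
      have "d y (weval v (x k)) < (1/2) ^ Suc i"
        using k(4) half_mono[OF \<open>Suc i \<le> j\<close>] by linarith
      then have "d (a * y) (q t * weval v (x k)) < (1/2) ^ i" "d (y * a) (weval v (x k) * q t) < (1/2) ^ i"
        using t mult_le[of a y "q t" "weval v (x k)"] mult_le[of y a "weval v (x k)" "q t"] commute[of a "q t"]
        by simp_all
      then show ?thesis
        using VI[OF _ words_append(2)[OF k(2) s], of i "a * y"]
          VI[OF _ words_append(1)[OF k(2) s], of i "y * a"] len v \<open>Suc i \<le> k\<close>
        by (simp add: weval_append weval_Cons)
    qed
    then show ?thesis by blast
  qed
  obtain b where b: "\<And>i. b \<in> V i"
  proof (rule zero_closed_no_filter[OF zc, of V])
    fix i
    have "[None] \<in> words (L x i)" by (simp add: words_def)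
    from VI[OF order_refl this, of "x i"] show "V i \<noteq> {}" by auto
    fix j
    show "\<exists>k. V k \<subseteq> V i \<inter> V j" using V_mono[of i "max i j"] V_mono[of j "max i j"] by auto
  qed (use mult trans in blast)+
  obtain w j \<delta> where w: "\<delta> > 0" "None \<in> set w" "\<And>y. d (weval w b) y < \<delta> \<Longrightarrow> y \<in> U j"
    using reach by metis
  have "\<exists>i'. \<forall>y\<in>V i'. weval w y \<in> V i" if "None \<in> set w" for i and w :: "'a option list"
    using that
  proof (induction w arbitrary: i)
    case (Cons l w)
    show ?case
    proof (cases "w = []")
      case True
      then show ?thesis using Cons.prems by auto
    next
      case False
      show ?thesis
      proof (cases "None \<in> set w")
        case True
        show ?thesis
        proof (cases l)
          case None
          obtain i' where "\<forall>y\<in>V i'. weval w y \<in> V (Suc i)" using Cons.IH[OF True] by blast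
          then have "\<forall>y\<in>V (max i' (Suc i)). weval (l # w) y \<in> V i"
            using V_mono[of i' "max i' (Suc i)"] V_mono[of "Suc i" "max i' (Suc i)"] None False
            by (auto simp: weval_Cons intro!: mult)
          then show ?thesis by blast
        next
          case (Some a)
          obtain j where j: "\<forall>y\<in>V j. a * y \<in> V i" using trans by blast
          obtain i' where "\<forall>y\<in>V i'. weval w y \<in> V j" using Cons.IH[OF True] by blast
          with j Some False show ?thesis by (auto simp: weval_Cons)
        qed
      next
        case noN: False
        \<comment> \<open>The variable occurs in the first letter only, so the rest of the word is a constant factor.\<close>
        then have l: "l = None" using Cons.prems by auto
        have "weval w y = weval w undefined" for y
          using noN by (rule weval_constant)
        moreover obtain j where "\<forall>y\<in>V j. y * weval w undefined \<in> V i" using trans by blast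
        ultimately have "\<forall>y\<in>V j. weval (l # w) y \<in> V i" using l False by (metis weval_Cons weval_single(1))
        then show ?thesis by blast
      qed
    qed
  qed simp
  with b w(2) have bV: "weval w b \<in> V i" for i by blast
  obtain i0 where i0: "(1/2 :: real) ^ i0 < \<delta>" using real_arch_pow_inv[OF w(1), of "1/2"] by auto
  define i where "i = max i0 j"
  from bV[of i] obtain k u where k: "i \<le> k" "u \<in> words (L x k)" "length u \<le> 2 ^ (k - i)"
    "d (weval w b) (weval u (x k)) < (1/2) ^ i"
    using V_def by blast
  have "(1/2 :: real) ^ i \<le> (1/2) ^ i0" by (rule half_mono) (simp add: i_def)
  then have "weval u (x k) \<in> U j" using k(4) i0 by (intro w(3)) linarith
  moreover have "length u \<le> 2 ^ k"
    using k(3) by (meson diff_le_self le_trans one_le_numeral power_increasing)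
  ultimately show False using x[OF k(2)] k(1) by (auto simp: i_def)
qed

end

section \<open>The core of a topological semigroup\<close>

text \<open>The values \<open>weval w z\<close> are the products in which \<open>z\<close> occurs as a factor, so they form the
  principal ideal of \<open>z\<close>.\<close>

definition traps :: "'a::semigroup_mult \<Rightarrow> 'a set set \<Rightarrow> 'a set \<Rightarrow> bool" where
  "traps z \<A> U \<longleftrightarrow> finite \<A> \<and> (\<forall>A\<in>\<A>. algebraic_subset A) \<and>
     (\<forall>w. None \<in> set w \<longrightarrow> weval w z \<in> U \<longrightarrow> weval w z \<in> \<Union>\<A>)"

definition trapped :: "'a::semigroup_mult topology \<Rightarrow> 'a set" where
  "trapped T = {b. \<exists>U z \<A>. openin T U \<and> b \<in> U \<and> traps z \<A> U}"

text \<open>Outside the core, points can be moved into sets that trap ideals, which is what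
  \<open>polybounded_of_escape\<close> needs; inside it, algebraic sets are small by
  \<open>core_not_locally_algebraic\<close>.\<close>

definition core :: "'a::semigroup_mult topology \<Rightarrow> 'a set" where
  "core T = {x. \<forall>w. None \<in> set w \<longrightarrow> weval w x \<notin> trapped T}"

lemma traps_mono: "traps z \<A> U \<Longrightarrow> V \<subseteq> U \<Longrightarrow> traps z \<A> V"
  unfolding traps_def by blast

lemma weval_in_core:
  assumes "x \<in> core T" "None \<in> set w"
  shows "weval w x \<in> core T"
proof -
  have "weval v (weval w x) \<notin> trapped T" if v: "None \<in> set v" for v
  proof -
    have "v \<noteq> []" "w \<noteq> []" using v assms(2) by auto
    then have "weval v (weval w x) = weval (wsubst w v) x" by (simp add: weval_wsubst)
    then show ?thesis using assms v None_in_wsubst[OF assms(2) v] by (simp add: core_def)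
  qed
  then show ?thesis by (simp add: core_def)
qed

text \<open>The ideal generated by \<open>z\<close> lies in the core. If an algebraic set contained the part of the core in \<open>U\<close>,
  then \<open>U\<close> would trap the ideal of \<open>z\<close> and \<open>z\<close> itself would be trapped.\<close>

lemma core_not_locally_algebraic:
  assumes "z \<in> core T" "openin T U" "z \<in> U" "algebraic_subset A"
  shows "\<exists>x\<in>core T. x \<in> U \<and> x \<notin> A"
proof (rule ccontr)
  assume "\<not> ?thesis"
  then have "traps z {A} U"
    using assms(1,4) weval_in_core unfolding traps_def by blast
  then have "weval [None] z \<in> trapped T"
    using assms(2,3) unfolding trapped_def by auto
  then show False using assms(1) unfolding core_def by (metis (mono_tags) list.set_intros(1) mem_Collect_eq)
qed

lemma closedin_core:
  assumes "topspace T = UNIV" "\<And>w. w \<noteq> [] \<Longrightarrow> continuous_map T T (weval w)"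
  shows "closedin T (core T)"
proof -
  have "openin T (trapped T)"
    unfolding trapped_def by (subst openin_subopen) blast
  then have "openin T {x \<in> topspace T. weval w x \<in> trapped T}" if "None \<in> set w" for w
    using that assms(2)[of w] openin_continuous_map_preimage by fastforce
  then have "openin T (\<Union>w\<in>{w. None \<in> set w}. {x \<in> topspace T. weval w x \<in> trapped T})"
    by (intro openin_Union) auto
  moreover have "(\<Union>w\<in>{w. None \<in> set w}. {x \<in> topspace T. weval w x \<in> trapped T}) = UNIV - core T"
    using assms(1) by (auto simp: core_def)
  ultimately show ?thesis using assms(1) by (simp add: closedin_def)
qed

text \<open>By \<open>algebraic_set_with_interior\<close>, a nonempty core would have a nonempty relatively open
  part in an algebraic set. So the core is empty; since the metric is separable, countably many balls
  trap all trapped points, and these balls serve as \<open>U j\<close> in \<open>polybounded_of_escape\<close>.\<close>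

lemma polybounded_complete_metric:
  fixes d :: "'a::semigroup_mult \<Rightarrow> 'a \<Rightarrow> real"
  assumes cov: "cov_M =o |UNIV :: real set|"
    and zc: "zero_closed TYPE('a)"
    and d: "Metric_space UNIV d" "Metric_space.mcomplete UNIV d"
      "separable_space (Metric_space.mtopology UNIV d)" "subinvariant d"
  shows "polybounded TYPE('a)"
proof -
  interpret M: Metric_space UNIV d by (rule d(1))
  interpret subinvariant_pseudometric d
  proof
    fix a x y z
    show "d x x = 0" "d x y = d y x" "d x z \<le> d x y + d y z"
      using M.triangle by (auto simp: M.commute)
    have "d (out1 (In1 a * In1 x * 1)) (out1 (In1 a * In1 y * 1)) \<le> d x y"
      "d (out1 (1 * In1 x * In1 a)) (out1 (1 * In1 y * In1 a)) \<le> d x y"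
      using d(4) unfolding subinvariant_def by blast+
    then show "d (a * x) (a * y) \<le> d x y" "d (x * a) (y * a) \<le> d x y" by simp_all
  qed
  define T where "T = M.mtopology"
  have topT: "topspace T = UNIV" by (simp add: T_def)
  have openT: "openin T U \<longleftrightarrow> (\<forall>x\<in>U. \<exists>r>0. \<forall>y. d x y < r \<longrightarrow> y \<in> U)" for U
    by (auto simp: T_def M.openin_mtopology subset_iff)
  obtain q where q: "dense_seq_on UNIV q"
  proof -
    obtain C where C: "countable C" "T closure_of C = UNIV"
      using d(3) by (auto simp: separable_space_def T_def)
    then have "C \<noteq> {}" by auto
    have "\<exists>n. d (from_nat_into C n) x < \<epsilon>" if "\<epsilon> > 0" for x \<epsilon>
    proof -
      have "x \<in> T closure_of C" using C(2) by simp
      then obtain c where "c \<in> C" "d x c < \<epsilon>"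
        using \<open>\<epsilon> > 0\<close> by (auto simp: T_def M.metric_closure_of)
      then show ?thesis
        using from_nat_into_surj[OF C(1)] commute[of x c] by metis
    qed
    then show thesis using that[of "from_nat_into C"] by (auto simp: dense_seq_on_def)
  qed
  have complete: "complete_on UNIV"
    unfolding complete_on_def
  proof (intro allI impI)
    fix \<sigma> :: "nat \<Rightarrow> 'a"
    assume "\<forall>\<epsilon>>0. \<exists>N. \<forall>m\<ge>N. \<forall>n\<ge>N. d (\<sigma> m) (\<sigma> n) < \<epsilon>"
    then have "M.MCauchy \<sigma>" by (simp add: M.MCauchy_def)
    then obtain x where "limitin M.mtopology \<sigma> x sequentially"
      using d(2) by (auto simp: M.mcomplete_def)
    then show "\<exists>z\<in>UNIV. \<forall>\<epsilon>>0. \<exists>N. \<forall>n\<ge>N. d (\<sigma> n) z < \<epsilon>"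
      by (auto simp: M.limit_metric_sequentially)
  qed
  have cont: "continuous_map T T (weval w)" if w: "w \<noteq> []" for w
    unfolding continuous_map_def
  proof (intro conjI allI impI)
    fix U assume U: "openin T U"
    have "\<exists>r>0. \<forall>y. d x y < r \<longrightarrow> weval w y \<in> U" if x: "weval w x \<in> U" for x
    proof -
      obtain r where r: "r > 0" "\<And>y. d (weval w x) y < r \<Longrightarrow> y \<in> U"
        using U x openT by blast
      have "weval w y \<in> U" if "d x y < r / length w" for y
      proof (rule r(2))
        have "length w * d x y < r" using that w by (simp add: field_simps)
        then show "d (weval w x) (weval w y) < r" using weval_Lipschitz[OF w, of x y] by linarith
      qed
      moreover have "r / length w > 0" using r(1) w by simp
      ultimately show ?thesis by blast
    qed
    then show "openin T {x \<in> topspace T. weval w x \<in> U}" by (simp add: openT topT)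
  qed (simp add: topT)
  have closed: "closedin T (core T)" by (rule closedin_core[OF topT cont])
  have core_complete: "complete_on (core T)"
    unfolding complete_on_def
  proof (intro allI impI)
    fix \<sigma> :: "nat \<Rightarrow> 'a"
    assume \<sigma>: "range \<sigma> \<subseteq> core T" "\<forall>\<epsilon>>0. \<exists>N. \<forall>m\<ge>N. \<forall>n\<ge>N. d (\<sigma> m) (\<sigma> n) < \<epsilon>"
    then obtain z where z: "\<And>\<epsilon>. \<epsilon> > 0 \<Longrightarrow> \<exists>N. \<forall>n\<ge>N. d (\<sigma> n) z < \<epsilon>"
      using complete unfolding complete_on_def by blast
    have "z \<in> core T"
    proof (rule ccontr)
      assume "z \<notin> core T"
      moreover have "openin T (UNIV - core T)" using closed by (simp add: closedin_def topT)
      ultimately obtain r where "r > 0" "\<And>y. d z y < r \<Longrightarrow> y \<notin> core T"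
        unfolding openT by blast
      moreover from z[OF this(1)] obtain n where "d (\<sigma> n) z < r" by blast
      ultimately show False using \<sigma>(1) commute[of z "\<sigma> n"] by (metis rangeI subsetD)
    qed
    with z show "\<exists>z\<in>core T. \<forall>\<epsilon>>0. \<exists>N. \<forall>n\<ge>N. d (\<sigma> n) z < \<epsilon>" by blast
  qed
  have empty: "core T = {}"
  proof (rule ccontr)
    assume "core T \<noteq> {}"
    from algebraic_set_with_interior[OF cov zc q core_complete this] obtain w b z \<epsilon>
      where w: "None \<in> set w" "z \<in> core T" "\<epsilon> > 0"
        "\<And>x. x \<in> core T \<Longrightarrow> d z x < \<epsilon> \<Longrightarrow> d (weval w x) b = 0" by metis
    have "openin T {x. d z x < \<epsilon>}"
      unfolding T_def using M.openin_mball[of z \<epsilon>] by (simp add: M.mball_def)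
    from core_not_locally_algebraic[OF w(2) this _ algebraic_weval[OF w(1), of b]] w(3,4) show False
      by (auto simp: M.zero)
  qed
  \<comment> \<open>Balls around \<open>q i\<close> of radius \<open>1 / (m + 1)\<close>; those that trap no ideal are replaced by the empty set.\<close>
  define B where "B n = (case prod_decode n of (i, m) \<Rightarrow> {x. d (q i) x < 1 / real (Suc m)})" for n
  define ok where "ok n \<longleftrightarrow> (\<exists>z \<A>. traps z \<A> (B n))" for n
  have "\<forall>n. \<exists>p. ok n \<longrightarrow> traps (fst p) (snd p) (B n)" by (auto simp: ok_def)
  then obtain p where p: "\<forall>n. ok n \<longrightarrow> traps (fst (p n)) (snd (p n)) (B n)"
    by (rule choice[THEN exE])
  define z and \<A> where "z n = fst (p n)" and "\<A> n = snd (p n)" for n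
  have z\<A>: "traps (z n) (\<A> n) (B n)" if "ok n" for n
    using p that by (simp add: z_def \<A>_def)
  define U where "U n = (if ok n then B n else {})" for n
  define \<A>' where "\<A>' n = (if ok n then \<A> n else {})" for n
  show ?thesis
  proof (rule polybounded_of_escape[OF zc q, of \<A>' z U])
    show "finite (\<A>' j)" for j using z\<A>[of j] by (simp add: \<A>'_def traps_def)
    show "algebraic_subset A" if "A \<in> \<A>' j" for j A
      using that z\<A>[of j] by (auto simp: \<A>'_def traps_def split: if_splits)
    show "weval w (z j) \<in> \<Union>(\<A>' j)" if "None \<in> set w" "weval w (z j) \<in> U j" for w j
      using that z\<A>[of j] by (auto simp: \<A>'_def U_def traps_def split: if_splits)
    fix b
    obtain w where w: "None \<in> set w" "weval w b \<in> trapped T" using empty by (auto simp: core_def)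
    define g where "g = weval w b"
    obtain V z' \<A>'' where V: "openin T V" "g \<in> V" "traps z' \<A>'' V"
      using w(2) by (auto simp: trapped_def g_def)
    obtain r where r: "r > 0" "\<And>y. d g y < r \<Longrightarrow> y \<in> V" using V(1,2) openT by blast
    obtain m where m: "1 / real (Suc m) < r / 2"
      using nat_approx_posE[of "r / 2"] r(1) by auto
    obtain i where i: "d (q i) g < 1 / real (Suc m)"
      using q unfolding dense_seq_on_def by (metis UNIV_I of_nat_0_less_iff zero_less_Suc zero_less_divide_1_iff)
    define n where "n = prod_encode (i, m)"
    have B: "B n = {x. d (q i) x < 1 / real (Suc m)}" by (simp add: B_def n_def)
    have "B n \<subseteq> V"
    proof
      fix x assume "x \<in> B n"
      then have "d g x < r"
        using m i triangle[of g x "q i"] commute[of g "q i"] by (simp add: B)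
      then show "x \<in> V" by (rule r(2))
    qed
    then have "ok n" using traps_mono[OF V(3)] unfolding ok_def by blast
    moreover have "y \<in> B n" if "d g y < 1 / real (Suc m) - d (q i) g" for y
      using that triangle[of "q i" y g] by (simp add: B)
    ultimately show "\<exists>w j. \<exists>\<delta>>0. None \<in> set w \<and> (\<forall>y. d (weval w b) y < \<delta> \<longrightarrow> y \<in> U j)"
      using i w(1) unfolding g_def[symmetric]
      by (intro exI[of _ w] exI[of _ n] exI[of _ "1 / real (Suc m) - d (q i) g"]) (auto simp: U_def g_def[symmetric])
  qed
qed

section \<open>Continuous pseudometrics on compact spaces\<close>

lemma compact_space_point_cover:
  assumes "compact_space T" "\<And>x. x \<in> topspace T \<Longrightarrow> openin T (N x) \<and> x \<in> N x"
  obtains F where "finite F" "topspace T \<subseteq> (\<Union>x\<in>F. N x)"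
proof -
  have "(\<forall>U\<in>N ` topspace T. openin T U) \<and> topspace T \<subseteq> \<Union>(N ` topspace T)"
    using assms(2) by blast
  then obtain \<F> where "finite \<F>" "\<F> \<subseteq> N ` topspace T" "topspace T \<subseteq> \<Union>\<F>"
    using assms(1) unfolding compact_space_alt by metis
  moreover from this obtain F where "finite F" "\<F> = N ` F" by (metis finite_subset_image)
  ultimately show thesis using that by blast
qed

definition continuous_pseudometric :: "'a topology \<Rightarrow> ('a \<Rightarrow> 'a \<Rightarrow> real) \<Rightarrow> bool" where
  "continuous_pseudometric T d \<longleftrightarrow> pseudometric d \<and> (\<forall>x y. d x y \<le> 1) \<and>
     (\<forall>x. \<forall>\<epsilon>>0. \<exists>N. openin T N \<and> x \<in> N \<and> (\<forall>y\<in>N. d x y < \<epsilon>))"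

lemma continuous_map_pseudometric:
  assumes d: "continuous_pseudometric T d"
    and F: "continuous_map Y T F" and G: "continuous_map Y T G"
  shows "continuous_map Y euclideanreal (\<lambda>p. d (F p) (G p))"
proof -
  interpret pseudometric d using d by (simp add: continuous_pseudometric_def)
  have "openin Y {p \<in> topspace Y. d (F p) (G p) \<in> S}" if S: "open S" for S
  proof (subst openin_subopen, intro ballI)
    fix p assume p: "p \<in> {p \<in> topspace Y. d (F p) (G p) \<in> S}"
    then obtain e where e: "e > 0" "ball (d (F p) (G p)) e \<subseteq> S"
      using S openE by blast
    obtain M where M: "openin T M" "F p \<in> M" "\<And>y. y \<in> M \<Longrightarrow> d (F p) y < e / 2"
      using d e(1) unfolding continuous_pseudometric_def by (meson half_gt_zero)
    obtain N where N: "openin T N" "G p \<in> N" "\<And>y. y \<in> N \<Longrightarrow> d (G p) y < e / 2"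
      using d e(1) unfolding continuous_pseudometric_def by (meson half_gt_zero)
    define P where "P = {p \<in> topspace Y. F p \<in> M} \<inter> {p \<in> topspace Y. G p \<in> N}"
    have "openin Y P"
      unfolding P_def using F G M(1) N(1) by (intro openin_Int openin_continuous_map_preimage)
    moreover have "p \<in> P" using p M(2) N(2) by (simp add: P_def)
    moreover have "d (F p') (G p') \<in> S" if "p' \<in> P" for p'
    proof -
      have "d (F p) (F p') < e / 2" "d (G p) (G p') < e / 2"
        using that M(3) N(3) by (auto simp: P_def)
      then have "\<bar>d (F p) (G p) - d (F p') (G p')\<bar> < e"
        using triangle[of "F p" "G p" "F p'"] triangle[of "F p'" "G p" "G p'"]
          triangle[of "F p'" "G p'" "F p"] triangle[of "F p" "G p'" "G p"]
          commute[of "F p'" "F p"] commute[of "G p'" "G p"] by linarith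
      then show ?thesis using e(2) by (auto simp: dist_real_def)
    qed
    ultimately show "\<exists>W. openin Y W \<and> p \<in> W \<and> W \<subseteq> {p \<in> topspace Y. d (F p) (G p) \<in> S}"
      by (intro exI[of _ P]) (auto simp: P_def)
  qed
  then show ?thesis by (simp add: continuous_map_def)
qed

text \<open>Taking the supremum over all translations makes a pseudometric subinvariant under them. The result
  remains continuous by the tube lemma, because the translations range over a compact space. The maximum
  with \<open>d\<close> accounts for the translation by the adjoined unit.\<close>

lemma translation_sup_pseudometric:
  fixes act :: "'a \<Rightarrow> 'a \<Rightarrow> 'a"
  assumes d: "continuous_pseudometric T d"
    and T: "compact_space T" "topspace T = UNIV"
    and act: "continuous_map (prod_topology T T) T (\<lambda>(u, x). act u x)"
  defines "d' \<equiv> \<lambda>x y. max (d x y) (SUP u. d (act u x) (act u y))"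
  shows "continuous_pseudometric T d'" and "d (act u x) (act u y) \<le> d' x y" and "d x y \<le> d' x y"
    and "(\<And>u. d (act u x) (act u y) \<le> c) \<Longrightarrow> d x y \<le> c \<Longrightarrow> d' x y \<le> c"
proof -
  interpret pseudometric d using d by (simp add: continuous_pseudometric_def)
  have le1: "d x y \<le> 1" for x y using d by (simp add: continuous_pseudometric_def)
  have bdd: "bdd_above (range (\<lambda>u. d (act u x) (act u y)))" for x y
    using le1 by (intro bdd_aboveI[of _ 1]) auto
  show act_le: "d (act u x) (act u y) \<le> d' x y" for u x y
    unfolding d'_def by (rule max.coboundedI2) (rule cSUP_upper[OF _ bdd], simp)
  show le: "d x y \<le> d' x y" for x y by (simp add: d'_def)
  show least: "d' x y \<le> c" if "\<And>u. d (act u x) (act u y) \<le> c" "d x y \<le> c" for x y c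
    unfolding d'_def using that by (intro max.boundedI cSUP_least) auto
  have "pseudometric d'"
  proof
    fix x y z
    show "d' x x = 0" by (simp add: d'_def)
    show "d' x y = d' y x" by (simp add: d'_def commute)
    show "d' x z \<le> d' x y + d' y z"
    proof (rule least)
      show "d (act u x) (act u z) \<le> d' x y + d' y z" for u
        using triangle[of "act u x" "act u z" "act u y"] act_le[of u x y] act_le[of u y z] by linarith
      show "d x z \<le> d' x y + d' y z"
        using triangle[of x z y] le[of x y] le[of y z] by linarith
    qed
  qed
  moreover have "\<exists>N. openin T N \<and> x \<in> N \<and> (\<forall>y\<in>N. d' x y < \<epsilon>)" if "\<epsilon> > 0" for x \<epsilon>
  proof -
    define W where "W = {p \<in> topspace (prod_topology T T).
      d (act (fst p) x) (act (fst p) (snd p)) \<in> {..<\<epsilon> / 2}}"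
    have F: "continuous_map (prod_topology T T) T (\<lambda>p. act (fst p) x)"
      using continuous_map_compose[OF _ act, of "prod_topology T T" "\<lambda>p. (fst p, x)"]
      by (simp add: o_def continuous_map_pairedI continuous_map_fst T(2))
    have G: "continuous_map (prod_topology T T) T (\<lambda>p. act (fst p) (snd p))"
      using act by (simp add: case_prod_beta')
    have "openin (prod_topology T T) W"
      unfolding W_def
      by (rule openin_continuous_map_preimage[OF continuous_map_pseudometric[OF d F G]]) simp
    moreover have "UNIV \<times> {x} \<subseteq> W" using \<open>\<epsilon> > 0\<close> by (auto simp: W_def T(2))
    ultimately obtain M N where N: "UNIV \<subseteq> M" "openin T N" "x \<in> N" "M \<times> N \<subseteq> W"
      using tube_lemma_left[of T T W UNIV x] T by (auto simp: compact_space_def)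
    obtain N' where N': "openin T N'" "x \<in> N'" "\<And>y. y \<in> N' \<Longrightarrow> d x y < \<epsilon> / 2"
      using d \<open>\<epsilon> > 0\<close> unfolding continuous_pseudometric_def by (meson half_gt_zero)
    have "d' x y < \<epsilon>" if "y \<in> N \<inter> N'" for y
    proof -
      have "d (act u x) (act u y) \<le> \<epsilon> / 2" for u
      proof -
        have "(u, y) \<in> W" using that N(1,4) by blast
        then show ?thesis by (simp add: W_def)
      qed
      then have "d' x y \<le> \<epsilon> / 2" using that N'(3) by (intro least) (auto intro: less_imp_le)
      then show ?thesis using \<open>\<epsilon> > 0\<close> by linarith
    qed
    then show ?thesis using N(2,3) N'(1,2) by (intro exI[of _ "N \<inter> N'"]) auto
  qed
  moreover have "d' x y \<le> 1" for x y using le1 by (intro least) auto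
  ultimately show "continuous_pseudometric T d'" by (simp add: continuous_pseudometric_def)
qed

text \<open>The weighted sum dominates each \<open>D n\<close> up to a factor, and it is small as soon as finitely many \<open>D n\<close>
  are: it defines the join of the topologies of the \<open>D n\<close>.\<close>

lemma pseudometric_join:
  assumes D: "\<And>n. continuous_pseudometric T (D n)" and T: "topspace T = UNIV"
  defines "d \<equiv> \<lambda>x y. \<Sum>n. (1/2) ^ Suc n * D n x y"
  shows "continuous_pseudometric T d"
    and "D n x y \<le> 2 ^ Suc n * d x y"
    and "\<epsilon> > 0 \<Longrightarrow> \<exists>N. \<forall>x y. (\<forall>n\<le>N. D n x y < \<epsilon>) \<longrightarrow> d x y < 2 * \<epsilon>"
    and "(\<And>n. D n x y \<le> D n x' y') \<Longrightarrow> d x y \<le> d x' y'"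
proof -
  have D': "pseudometric (D n)" for n using D by (simp add: continuous_pseudometric_def)
  note [simp] = pseudometric.zero[OF D'] pseudometric.nonneg[OF D']
  have le1: "D n x y \<le> 1" for n x y using D by (simp add: continuous_pseudometric_def)
  define f where "f x y n = (1/2) ^ Suc n * D n x y" for x y n
  have f: "0 \<le> f x y n" "f x y n \<le> (1/2) ^ Suc n" for x y n
    using le1[of n x y] by (simp_all add: f_def mult_left_le)
  have half: "summable (\<lambda>n. (1/2 :: real) ^ Suc n)" "(\<Sum>n. (1/2 :: real) ^ Suc n) = 1"
    using power_half_series by (auto simp: sums_iff)
  have sm: "summable (f x y)" for x y
    using f by (intro summable_comparison_test'[OF half(1), of 0]) simp
  have d: "d x y = suminf (f x y)" for x y unfolding d_def f_def ..
  show mono: "d x y \<le> d x' y'" if "\<And>n. D n x y \<le> D n x' y'" for x y x' y'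
    unfolding d using that by (intro suminf_le sm) (simp add: f_def)
  show "D n x y \<le> 2 ^ Suc n * d x y" for n x y
  proof -
    have "f x y n \<le> d x y"
      unfolding d using sum_le_suminf[OF sm, of "{n}" x y] f by simp
    then show ?thesis by (simp add: f_def power_one_over field_simps)
  qed
  show close: "\<exists>N. \<forall>x y. (\<forall>n\<le>N. D n x y < \<epsilon>) \<longrightarrow> d x y < 2 * \<epsilon>" if "\<epsilon> > 0" for \<epsilon>
  proof -
    obtain N where N: "(1/2 :: real) ^ N < \<epsilon>" using real_arch_pow_inv[OF \<open>\<epsilon> > 0\<close>, of "1/2"] by auto
    have "d x y < 2 * \<epsilon>" if small: "\<forall>n\<le>N. D n x y < \<epsilon>" for x y
    proof -
      have "d x y = (\<Sum>n. f x y (n + N)) + (\<Sum>n<N. f x y n)"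
        unfolding d by (rule suminf_split_initial_segment[OF sm])
      also have "(\<Sum>n. f x y (n + N)) \<le> (\<Sum>n. (1/2) ^ N * (1/2) ^ Suc n)"
      proof (rule suminf_le)
        show "f x y (n + N) \<le> (1/2) ^ N * (1/2) ^ Suc n" for n
          using f(2)[of x y "n + N"] by (simp add: power_add mult.commute)
        show "summable (\<lambda>n. f x y (n + N))" using sm by (rule summable_ignore_initial_segment)
        show "summable (\<lambda>n. (1/2 :: real) ^ N * (1/2) ^ Suc n)" using half(1) by (rule summable_mult)
      qed
      also have "\<dots> = (1/2) ^ N" using suminf_mult[OF half(1), of "(1/2) ^ N"] half(2) by simp
      also have "(\<Sum>n<N. f x y n) \<le> (\<Sum>n<N. (1/2) ^ Suc n * \<epsilon>)"
        using small unfolding f_def by (intro sum_mono mult_left_mono) (auto intro: less_imp_le)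
      also have "\<dots> = (\<Sum>n<N. (1/2) ^ Suc n) * \<epsilon>" by (simp only: sum_distrib_right)
      also have "(\<Sum>n<N. (1/2 :: real) ^ Suc n) \<le> 1"
        using sum_le_suminf[OF half(1), of "{..<N}"] half(2) by simp
      finally show ?thesis using N \<open>\<epsilon> > 0\<close> by simp
    qed
    then show ?thesis by blast
  qed
  have "pseudometric d"
  proof
    fix x y z
    have "f x x = (\<lambda>_. 0)" by (auto simp: f_def)
    then show "d x x = 0" by (simp add: d)
    have "f x y = f y x" by (auto simp: f_def pseudometric.commute[OF D', of _ x y])
    then show "d x y = d y x" by (simp add: d)
    have "d x z \<le> (\<Sum>n. f x y n + f y z n)"
      unfolding d using pseudometric.triangle[OF D', of _ x z y]
      by (intro suminf_le sm summable_add) (simp add: f_def flip: distrib_left)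
    then show "d x z \<le> d x y + d y z" by (simp add: d suminf_add sm)
  qed
  moreover have "d x y \<le> 1" for x y
    unfolding d using suminf_le[OF f(2) sm half(1)] half(2) by simp
  moreover have "\<exists>N. openin T N \<and> x \<in> N \<and> (\<forall>y\<in>N. d x y < \<epsilon>)" if "\<epsilon> > 0" for x \<epsilon>
  proof -
    have "\<epsilon> / 2 > 0" using that by simp
    from close[OF this] obtain N where N: "\<And>y. \<forall>n\<le>N. D n x y < \<epsilon> / 2 \<Longrightarrow> d x y < \<epsilon>" by auto
    have "\<forall>n. \<exists>M. openin T M \<and> x \<in> M \<and> (\<forall>y\<in>M. D n x y < \<epsilon> / 2)"
      using D \<open>\<epsilon> / 2 > 0\<close> unfolding continuous_pseudometric_def by blast
    then obtain M where M: "\<forall>n. openin T (M n) \<and> x \<in> M n \<and> (\<forall>y\<in>M n. D n x y < \<epsilon> / 2)"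
      by (rule choice[THEN exE])
    have "openin T (\<Inter>n\<le>N. M n)" using M by (intro openin_INT2) auto
    then show ?thesis using M N by (intro exI[of _ "\<Inter>n\<le>N. M n"]) auto
  qed
  ultimately show "continuous_pseudometric T d" by (simp add: continuous_pseudometric_def)
qed

section \<open>Compact semigroups\<close>

text \<open>A shape is a word whose constants are parameters named by natural numbers. There are only countably
  many shapes, and the values of the parameters range over a compact power of the semigroup.\<close>

definition inst :: "(nat \<Rightarrow> 'a) \<Rightarrow> nat option list \<Rightarrow> 'a option list" where
  "inst a w = map (map_option a) w"

lemma None_in_inst [simp]: "None \<in> set (inst a w) \<longleftrightarrow> None \<in> set w"
  by (force simp: inst_def)

text \<open>Every equation \<open>weval v x = b\<close> is an instance of \<open>weval (inst a w) x = a 0\<close>: parameter \<open>0\<close> is kept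
  for the right-hand side, and the letter at position \<open>i\<close> becomes parameter \<open>i + 1\<close>.\<close>

lemma inst_parameters:
  fixes v :: "'a option list"
  obtains a w where "inst a w = v" "a 0 = b"
proof
  define a where "a i = (if i = 0 then b else the (v ! (i - 1)))" for i :: nat
  show "inst a (map (\<lambda>i. map_option (\<lambda>_. Suc i) (v ! i)) [0..<length v]) = v"
  proof (rule nth_equalityI)
    fix i assume "i < length (inst a (map (\<lambda>i. map_option (\<lambda>_. Suc i) (v ! i)) [0..<length v]))"
    then have "i < length v" by (simp add: inst_def)
    then show "inst a (map (\<lambda>i. map_option (\<lambda>_. Suc i) (v ! i)) [0..<length v]) ! i = v ! i"
      by (cases "v ! i") (simp_all add: inst_def a_def)
  qed (simp add: inst_def)
  show "a 0 = b" by (simp add: a_def)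
qed

locale compact_semigroup =
  fixes T :: "'a::semigroup_mult topology"
  assumes semigroup: "semigroup_topology T" and compact: "compact_space T" and Hausdorff: "Hausdorff_space T"
begin

lemma topspace [simp]: "topspace T = UNIV"
  and continuous_mult: "continuous_map (prod_topology T T) T (\<lambda>(x, y). x * y)"
  using semigroup by (simp_all add: semigroup_topology_def)

lemma continuous_map_mult:
  assumes "continuous_map Y T f" "continuous_map Y T g"
  shows "continuous_map Y T (\<lambda>p. f p * g p)"
  using continuous_map_compose[OF continuous_map_pairedI[OF assms] continuous_mult]
  by (simp add: o_def)

lemma continuous_weval:
  assumes "w \<noteq> []"
  shows "continuous_map T T (weval w)"
proof -
  have letter: "continuous_map T T (weval [l])" for l
  proof (cases l)
    case None
    then have "weval [l] = (\<lambda>x. x)" by auto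
    then show ?thesis by simp
  next
    case (Some a)
    then have "weval [l] = (\<lambda>x. a)" by auto
    then show ?thesis by simp
  qed
  show ?thesis
    using assms
  proof (induction w rule: weval_induct)
    case (Cons l w)
    have "weval (l # w) = (\<lambda>x. weval [l] x * weval w x)"
      using Cons(1) by (simp add: weval_Cons[of w] fun_eq_iff)
    then show ?case using continuous_map_mult[OF letter Cons(2)] by simp
  qed (rule letter)
qed

lemma continuous_parameter: "continuous_map (product_topology (\<lambda>_. T) UNIV) T (\<lambda>a. a i)"
  using continuous_map_product_projection[of i UNIV "\<lambda>_. T"] by simp

lemma continuous_weval_inst:
  "w \<noteq> [] \<Longrightarrow> continuous_map (product_topology (\<lambda>_. T) UNIV) T (\<lambda>a. weval (inst a w) x)"
proof (induction w rule: weval_induct)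
  case (letter l)
  then show ?case by (cases l) (simp_all add: inst_def continuous_parameter)
next
  case (Cons l w)
  have "continuous_map (product_topology (\<lambda>_. T) UNIV) T (\<lambda>a. weval (inst a [l]) x)"
    by (cases l) (simp_all add: inst_def continuous_parameter)
  moreover have "weval (inst a (l # w)) x = weval (inst a [l]) x * weval (inst a w) x" for a
    using weval_append[of "inst a [l]" "inst a w"] Cons(1) by (simp add: inst_def)
  ultimately show ?case using continuous_map_mult Cons(2) by simp
qed

text \<open>Admissible pseudometrics define the metrizable quotient semigroups of \<open>X\<close>.\<close>

definition admissible :: "('a \<Rightarrow> 'a \<Rightarrow> real) \<Rightarrow> bool" where
  "admissible d \<longleftrightarrow> continuous_pseudometric T d \<and> subinvariant_pseudometric d"

lemma admissible_imp_pseudometric: "admissible d \<Longrightarrow> pseudometric d"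
  by (simp add: admissible_def continuous_pseudometric_def)

text \<open>Start from a Urysohn function \<open>f\<close> with value \<open>0\<close> at \<open>g\<close> and \<open>1\<close> outside \<open>U\<close>, and make
  \<open>\<bar>f x - f y\<bar>\<close> subinvariant under left and then under right translations. The second step
  preserves left subinvariance because left and right translations commute.\<close>

lemma admissible_separating:
  assumes U: "openin T U" "g \<in> U"
  obtains d where "admissible d" "\<And>y. d g y < 1 \<Longrightarrow> y \<in> U"
proof -
  have "normal_space T"
    using compact Hausdorff compact_Hausdorff_or_regular_imp_normal_space by blast
  moreover have "closedin T {g}"
    using Hausdorff closedin_Hausdorff_sing_eq by fastforce
  moreover have "closedin T (UNIV - U)" using U(1) by (simp add: closedin_def double_diff)
  moreover have "disjnt {g} (UNIV - U)" using U(2) by (simp add: disjnt_def)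
  ultimately obtain f where f: "continuous_map T (top_of_set {0..1::real}) f"
    "f ` {g} \<subseteq> {0}" "f ` (UNIV - U) \<subseteq> {1}"
    by (rule Urysohn_lemma[OF _ _ _ _ zero_le_one])
  have f01: "0 \<le> f x" "f x \<le> 1" for x
    using f(1) by (auto simp: continuous_map_in_subtopology image_subset_iff Pi_iff)
  have fc: "continuous_map T euclideanreal f"
    using f(1) continuous_map_in_subtopology by blast
  define d0 where "d0 x y = \<bar>f x - f y\<bar>" for x y
  have d0: "continuous_pseudometric T d0"
    unfolding continuous_pseudometric_def
  proof (intro conjI allI impI)
    show "pseudometric d0" by unfold_locales (auto simp: d0_def)
    show "d0 x y \<le> 1" for x y using f01[of x] f01[of y] by (auto simp: d0_def)
    fix x and \<epsilon> :: real assume "\<epsilon> > 0"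
    have "openin T {y \<in> topspace T. f y \<in> ball (f x) \<epsilon>}"
      by (rule openin_continuous_map_preimage[OF fc]) simp
    then show "\<exists>N. openin T N \<and> x \<in> N \<and> (\<forall>y\<in>N. d0 x y < \<epsilon>)"
      using \<open>\<epsilon> > 0\<close>
      by (intro exI[of _ "{y \<in> topspace T. f y \<in> ball (f x) \<epsilon>}"]) (auto simp: d0_def dist_real_def)
  qed
  define d1 where "d1 x y = max (d0 x y) (SUP u. d0 (u * x) (u * y))" for x y
  note d1 = translation_sup_pseudometric[OF d0 compact topspace continuous_mult, folded d1_def]
  have "continuous_map (prod_topology T T) T (\<lambda>p. snd p * fst p)"
    by (intro continuous_map_mult continuous_map_fst continuous_map_snd)
  then have swapped: "continuous_map (prod_topology T T) T (\<lambda>(u, x). x * u)"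
    by (simp add: case_prod_beta')
  define d2 where "d2 x y = max (d1 x y) (SUP u. d1 (x * u) (y * u))" for x y
  note d2 = translation_sup_pseudometric[OF d1(1) compact topspace swapped, folded d2_def]
  have d1_left: "d1 (a * x) (a * y) \<le> d1 x y" for a x y
    using d1(2)[of "_ * a" x y] d1(2)[of a x y] by (intro d1(4)) (simp_all add: mult.assoc)
  have "d2 (a * x) (a * y) \<le> d2 x y" for a x y
  proof (rule d2(4))
    show "d1 (a * x * u) (a * y * u) \<le> d2 x y" for u
      using d1_left[of a "x * u" "y * u"] d2(2)[of x u y] by (simp add: mult.assoc)
    show "d1 (a * x) (a * y) \<le> d2 x y" using d1_left[of a x y] d2(3)[of x y] by linarith
  qed
  moreover have "d2 (x * a) (y * a) \<le> d2 x y" for a x y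
    using d2(2)[of x "a * _" y] d2(2)[of x a y] by (intro d2(4)) (simp_all add: mult.assoc)
  ultimately have "subinvariant_pseudometric d2"
    using d2(1) by (simp add: continuous_pseudometric_def subinvariant_pseudometric_def
        subinvariant_pseudometric_axioms_def)
  with d2(1) have "admissible d2" by (simp add: admissible_def)
  moreover have "y \<in> U" if "d2 g y < 1" for y
  proof (rule ccontr)
    assume "y \<notin> U"
    then have "d0 g y = 1" using f(2,3) by (auto simp: d0_def image_subset_iff)
    with that d1(3)[of g y] d2(3)[of g y] show False by linarith
  qed
  ultimately show thesis using that by blast
qed

lemma admissible_join:
  assumes D: "\<And>n. admissible (D n)"
  shows "\<exists>d. admissible d \<and> (\<forall>n x y. D n x y \<le> 2 ^ Suc n * d x y) \<and>
    (\<forall>\<epsilon>>0. \<exists>N. \<forall>x y. (\<forall>n\<le>N. D n x y < \<epsilon>) \<longrightarrow> d x y < 2 * \<epsilon>)"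
proof -
  have cD: "continuous_pseudometric T (D n)" for n using D by (simp add: admissible_def)
  have sD: "subinvariant_pseudometric (D n)" for n using D by (simp add: admissible_def)
  define d where "d x y = (\<Sum>n. (1/2) ^ Suc n * D n x y)" for x y
  note join = pseudometric_join[of T D, OF cD topspace, folded d_def]
  have "subinvariant_pseudometric d"
    unfolding subinvariant_pseudometric_def subinvariant_pseudometric_axioms_def
    using join(1) join(4) subinvariant_pseudometric.left[OF sD] subinvariant_pseudometric.right[OF sD]
    by (simp add: continuous_pseudometric_def)
  then have "admissible d" using join(1) by (simp add: admissible_def)
  with join(2,3) show ?thesis by blast
qed

lemma admissible_finite_join:
  assumes "finite F" "\<And>x. x \<in> F \<Longrightarrow> admissible (D x)" "F \<noteq> {}"
  obtains d where "admissible d" "\<And>x. x \<in> F \<Longrightarrow> \<exists>c>0. \<forall>y z. D x y z \<le> c * d y z"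
proof -
  have F: "countable F" using assms(1) by (simp add: countable_finite)
  have adm: "admissible (D (from_nat_into F n))" for n
    using assms(2) from_nat_into[OF assms(3)] by blast
  obtain d where d: "admissible d" "\<forall>n x y. D (from_nat_into F n) x y \<le> 2 ^ Suc n * d x y"
    using admissible_join[of "\<lambda>n. D (from_nat_into F n)", OF adm] by (elim exE conjE) (rule that)
  have "\<exists>c>0. \<forall>y z. D x y z \<le> c * d y z" if "x \<in> F" for x
  proof -
    obtain n where "from_nat_into F n = x" using from_nat_into_surj[OF F \<open>x \<in> F\<close>] by blast
    with d(2) have "D x y z \<le> 2 ^ Suc n * d y z" for y z by metis
    then show ?thesis by (intro exI[of _ "2 ^ Suc n"]) simp
  qed
  with d(1) that show thesis by blast
qed

lemma admissible_separable:
  assumes "admissible d"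
  obtains q where "pseudometric.dense_seq_on d UNIV q"
proof -
  interpret pseudometric d using assms by (rule admissible_imp_pseudometric)
  have c: "continuous_pseudometric T d" using assms by (simp add: admissible_def)
  have "\<exists>F. finite F \<and> (\<forall>x. \<exists>z\<in>F. d z x < 1 / real (Suc m))" for m
  proof -
    have "openin T {x \<in> topspace T. d z x \<in> {..<1 / real (Suc m)}}" for z
      using continuous_map_pseudometric[OF c, of T "\<lambda>_. z" "\<lambda>x. x"]
      by (intro openin_continuous_map_preimage) auto
    then have "\<And>z. z \<in> topspace T \<Longrightarrow> openin T {x. d z x < 1 / real (Suc m)} \<and> z \<in> {x. d z x < 1 / real (Suc m)}"
      by simp
    from compact_space_point_cover[OF compact this] obtain F
      where "finite F" "topspace T \<subseteq> (\<Union>z\<in>F. {x. d z x < 1 / real (Suc m)})" by blast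
    then show ?thesis by (intro exI[of _ F]) auto
  qed
  then obtain F where F: "\<And>m. finite (F m)" "\<And>m x. \<exists>z\<in>F m. d z x < 1 / real (Suc m)" by metis
  define C where "C = (\<Union>m. F m)"
  have "countable C" using F(1) by (auto simp: C_def countable_finite)
  have "\<exists>n. d (from_nat_into C n) x < \<epsilon>" if \<epsilon>: "\<epsilon> > 0" for x \<epsilon>
  proof -
    obtain m where m: "1 / real (Suc m) < \<epsilon>" using nat_approx_posE[OF \<epsilon>] by auto
    obtain z where "z \<in> F m" "d z x < 1 / real (Suc m)" using F(2) by blast
    then have "z \<in> C" by (auto simp: C_def)
    then obtain n where "from_nat_into C n = z" using from_nat_into_surj[OF \<open>countable C\<close>] by blast
    with \<open>d z x < 1 / real (Suc m)\<close> m show ?thesis by (intro exI[of _ n]) simp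
  qed
  then have "dense_seq_on UNIV (from_nat_into C)" by (simp add: dense_seq_on_def)
  then show thesis by (rule that)
qed

text \<open>A sequence in a compact space has a cluster point, and a Cauchy sequence converges to it in each
  continuous pseudometric.\<close>

lemma admissible_complete:
  assumes d: "admissible d" and Z: "closedin T Z"
  shows "pseudometric.complete_on d Z"
proof -
  interpret pseudometric d using d by (rule admissible_imp_pseudometric)
  show ?thesis
    unfolding complete_on_def
  proof (intro allI impI)
    fix \<sigma> :: "nat \<Rightarrow> 'a"
    assume \<sigma>: "range \<sigma> \<subseteq> Z" "\<forall>\<epsilon>>0. \<exists>N. \<forall>m\<ge>N. \<forall>n\<ge>N. d (\<sigma> m) (\<sigma> n) < \<epsilon>"
    have "\<exists>z. \<forall>N. openin T N \<and> z \<in> N \<longrightarrow> infinite {n. \<sigma> n \<in> N}"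
    proof (rule ccontr)
      assume "\<not> ?thesis"
      then obtain N where N: "\<And>z. openin T (N z) \<and> z \<in> N z" "\<And>z. finite {n. \<sigma> n \<in> N z}" by metis
      from compact_space_point_cover[OF compact N(1)] obtain F
        where F: "finite F" "topspace T \<subseteq> (\<Union>z\<in>F. N z)" by blast
      have "(UNIV :: nat set) = (\<Union>z\<in>F. {n. \<sigma> n \<in> N z})" using F(2) by auto
      with F(1) N(2) show False using infinite_UNIV_nat by (metis finite_UN)
    qed
    then obtain z where z: "\<And>N. openin T N \<Longrightarrow> z \<in> N \<Longrightarrow> infinite {n. \<sigma> n \<in> N}" by blast
    have "z \<in> Z"
    proof (rule ccontr)
      assume "z \<notin> Z"
      with Z z[of "UNIV - Z"] have "infinite {n. \<sigma> n \<in> UNIV - Z}" by (simp add: closedin_def)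
      moreover have "{n. \<sigma> n \<in> UNIV - Z} = {}" using \<sigma>(1) by auto
      ultimately show False by simp
    qed
    moreover have "\<exists>N. \<forall>n\<ge>N. d (\<sigma> n) z < \<epsilon>" if \<epsilon>: "\<epsilon> > 0" for \<epsilon>
    proof -
      obtain N where N: "\<And>m n. m \<ge> N \<Longrightarrow> n \<ge> N \<Longrightarrow> d (\<sigma> m) (\<sigma> n) < \<epsilon> / 2"
        using \<sigma>(2) \<epsilon> by (meson half_gt_zero)
      obtain M where M: "openin T M" "z \<in> M" "\<And>y. y \<in> M \<Longrightarrow> d z y < \<epsilon> / 2"
        using d \<epsilon> unfolding admissible_def continuous_pseudometric_def by (meson half_gt_zero)
      obtain m where m: "m \<ge> N" "\<sigma> m \<in> M"
        using z[OF M(1,2)] unfolding infinite_nat_iff_unbounded_le by auto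
      have "d (\<sigma> n) z < \<epsilon>" if "n \<ge> N" for n
        using triangle[of "\<sigma> n" z "\<sigma> m"] N[OF that m(1)] M(3)[OF m(2)] commute[of z "\<sigma> m"] by linarith
      then show ?thesis by blast
    qed
    ultimately show "\<exists>z\<in>Z. \<forall>\<epsilon>>0. \<exists>N. \<forall>n\<ge>N. d (\<sigma> n) z < \<epsilon>" by blast
  qed
qed

text \<open>Each point \<open>x\<close> is moved by a polynomial into a trapping set \<open>U x\<close>, which contains a ball of an admissible
  pseudometric \<open>D x\<close>. By compactness finitely many \<open>U x\<close> suffice, and the finitely many \<open>D x\<close>
  are dominated by one admissible pseudometric.\<close>

lemma polybounded_core_empty:
  assumes zc: "zero_closed TYPE('a)" and empty: "core T = {}"
  shows "polybounded TYPE('a)"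
proof -
  have "\<exists>w U z \<A> d. None \<in> set w \<and> traps z \<A> U \<and> admissible d \<and>
      (\<forall>y. d (weval w x) y < 1 \<longrightarrow> y \<in> U)" for x
  proof -
    obtain w where w: "None \<in> set w" "weval w x \<in> trapped T" using empty by (auto simp: core_def)
    then obtain U z \<A> where U: "openin T U" "weval w x \<in> U" "traps z \<A> U" by (auto simp: trapped_def)
    with w(1) show ?thesis using admissible_separating[OF U(1,2)] by metis
  qed
  then obtain w U z \<A> D where *: "\<And>x :: 'a. None \<in> set (w x)" "\<And>x. traps (z x) (\<A> x) (U x)"
    "\<And>x. admissible (D x)" "\<And>x y. D x (weval (w x) x) y < 1 \<Longrightarrow> y \<in> U x"
    by metis
  define N where "N x = {y. D x (weval (w x) x) (weval (w x) y) < 1/2}" for x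
  have "openin T (N x) \<and> x \<in> N x" for x
  proof
    interpret pseudometric "D x" by (rule admissible_imp_pseudometric[OF *(3)])
    show "x \<in> N x" by (simp add: N_def)
    have "w x \<noteq> []" using *(1)[of x] by auto
    then have "continuous_map T euclideanreal (\<lambda>y. D x (weval (w x) x) (weval (w x) y))"
      using *(3)[of x] by (intro continuous_map_pseudometric[of T]) (auto simp: admissible_def continuous_weval)
    then have "openin T {y \<in> topspace T. D x (weval (w x) x) (weval (w x) y) \<in> {..<1/2}}"
      by (rule openin_continuous_map_preimage) simp
    then show "openin T (N x)" by (simp add: N_def)
  qed
  from compact_space_point_cover[OF compact this] obtain F
    where F: "finite F" "topspace T \<subseteq> (\<Union>x\<in>F. N x)" by blast
  then have "F \<noteq> {}" by auto
  from admissible_finite_join[of F D, OF F(1) *(3) this] obtain d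
    where d: "admissible d" "\<And>x. x \<in> F \<Longrightarrow> \<exists>c>0. \<forall>y z. D x y z \<le> c * d y z" by blast
  obtain q where q: "pseudometric.dense_seq_on d UNIV q" using admissible_separable[OF d(1)] by blast
  interpret subinvariant_pseudometric d using d(1) by (simp add: admissible_def)
  define e where "e = from_nat_into F"
  have tr: "traps (z (e j)) (\<A> (e j)) (U (e j))" for j by (rule *(2))
  show ?thesis
  proof (rule polybounded_of_escape[OF zc q, of "\<lambda>j. \<A> (e j)" "\<lambda>j. z (e j)" "\<lambda>j. U (e j)"])
    show "finite (\<A> (e j))" for j using tr[of j] by (simp add: traps_def)
    show "algebraic_subset A" if "A \<in> \<A> (e j)" for j A using that tr[of j] by (simp add: traps_def)
    show "weval v (z (e j)) \<in> \<Union>(\<A> (e j))" if "None \<in> set v" "weval v (z (e j)) \<in> U (e j)" for v j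
      using that tr[of j] by (simp add: traps_def)
    fix b
    obtain x where x: "x \<in> F" "b \<in> N x" using F(2) by auto
    obtain j where j: "e j = x"
      using from_nat_into_surj[of F x] F(1) x(1) by (auto simp: e_def countable_finite)
    obtain c where c: "c > 0" "\<And>y z. D x y z \<le> c * d y z" using d(2)[OF x(1)] by blast
    have "y \<in> U (e j)" if "d (weval (w x) b) y < 1 / (2 * c)" for y
    proof -
      have "c * d (weval (w x) b) y < 1 / 2" using that c(1) by (simp add: field_simps)
      then have "D x (weval (w x) b) y < 1 / 2" using c(2)[of "weval (w x) b" y] by linarith
      then have "D x (weval (w x) x) y < 1"
        using x(2) pseudometric.triangle[OF admissible_imp_pseudometric[OF *(3)[of x]], of "weval (w x) x" y "weval (w x) b"]
        by (simp add: N_def)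
      then show ?thesis using *(4) j by simp
    qed
    then show "\<exists>w j. \<exists>\<delta>>0. None \<in> set w \<and> (\<forall>y. d (weval w b) y < \<delta> \<longrightarrow> y \<in> U (e j))"
      using *(1)[of x] c(1) by (intro exI[of _ "w x"] exI[of _ j] exI[of _ "1 / (2 * c)"]) auto
  qed
qed

text \<open>For each choice \<open>a\<close> of the parameters, some point of the core in \<open>W\<close> violates the equation, and some
  admissible pseudometric witnesses it, also for the parameters near \<open>a\<close>. As the space of parameters is
  compact, one pseudometric works for all.\<close>

lemma admissible_refuting:
  assumes W: "openin T W" "core T \<inter> W \<noteq> {}" and w: "None \<in> set w"
  obtains d where "admissible d" "\<And>a. \<exists>x\<in>core T \<inter> W. d (weval (inst a w) x) (a 0) > 0"
proof -
  define Y where "Y = product_topology (\<lambda>_ :: nat. T) UNIV"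
  have Y: "compact_space Y" "topspace Y = UNIV"
    by (simp add: Y_def compact_space_product_topology compact) (simp add: Y_def)
  obtain z where z: "z \<in> core T" "z \<in> W" using W(2) by blast
  have "\<exists>x d. x \<in> core T \<inter> W \<and> admissible d \<and> d (weval (inst a w) x) (a 0) > 0" for a
  proof -
    have "algebraic_subset {x. weval (inst a w) x = a 0}" using w by (intro algebraic_weval) simp
    from core_not_locally_algebraic[OF z(1) W(1) z(2) this]
    obtain x where x: "x \<in> core T \<inter> W" "weval (inst a w) x \<noteq> a 0" by auto
    have "closedin T {a 0}" using Hausdorff closedin_Hausdorff_sing_eq by fastforce
    then have "openin T (UNIV - {a 0})" by (simp add: closedin_def)
    from admissible_separating[OF this, of "weval (inst a w) x"] x(2)
    obtain d where d: "admissible d" "\<And>y. d (weval (inst a w) x) y < 1 \<Longrightarrow> y \<in> UNIV - {a 0}" by blast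
    then have "d (weval (inst a w) x) (a 0) \<ge> 1" using linorder_not_le by blast
    then show ?thesis using x(1) d(1) by (metis less_le_trans zero_less_one)
  qed
  then obtain X D where XD: "\<And>a. X a \<in> core T \<inter> W" "\<And>a. admissible (D a)"
    "\<And>a. D a (weval (inst a w) (X a)) (a 0) > 0" by metis
  define N where "N a = {a'. D a (weval (inst a' w) (X a)) (a' 0) > 0}" for a
  have "openin Y (N a) \<and> a \<in> N a" for a
  proof
    show "a \<in> N a" using XD by (simp add: N_def)
    have "w \<noteq> []" using w by auto
    then have "continuous_map Y euclideanreal (\<lambda>a'. D a (weval (inst a' w) (X a)) (a' 0))"
      using XD(2)[of a] continuous_parameter continuous_weval_inst unfolding Y_def
      by (intro continuous_map_pseudometric[of T]) (auto simp: admissible_def)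
    then have "openin Y {a' \<in> topspace Y. D a (weval (inst a' w) (X a)) (a' 0) \<in> {0<..}}"
      by (rule openin_continuous_map_preimage) simp
    then show "openin Y (N a)" by (simp add: N_def Y(2))
  qed
  from compact_space_point_cover[OF Y(1) this] obtain F
    where F: "finite F" "topspace Y \<subseteq> (\<Union>a\<in>F. N a)" by blast
  then have "F \<noteq> {}" using Y(2) by auto
  from admissible_finite_join[of F D, OF F(1) XD(2) this] obtain d
    where d: "admissible d" "\<And>a. a \<in> F \<Longrightarrow> \<exists>c>0. \<forall>y z. D a y z \<le> c * d y z" by blast
  have "\<exists>x\<in>core T \<inter> W. d (weval (inst a w) x) (a 0) > 0" for a
  proof -
    obtain a' where a': "a' \<in> F" "a \<in> N a'" using F(2) Y(2) by auto
    obtain c where c: "c > 0" "\<And>y z. D a' y z \<le> c * d y z" using d(2)[OF a'(1)] by blast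
    have "0 < D a' (weval (inst a w) (X a')) (a 0)" using a'(2) by (simp add: N_def)
    also have "\<dots> \<le> c * d (weval (inst a w) (X a')) (a 0)" by (rule c(2))
    finally have "0 < d (weval (inst a w) (X a')) (a 0)" using c(1) by (simp add: zero_less_mult_iff)
    then show ?thesis using XD(1) by blast
  qed
  with d(1) that show thesis by blast
qed

text \<open>The topology of \<open>d'\<close> is finer than that of \<open>d\<close>, and \<open>d'\<close> sees that no equation holds throughout the
  part of the core in a ball of \<open>d\<close>.\<close>

definition refines :: "('a \<Rightarrow> 'a \<Rightarrow> real) \<Rightarrow> ('a \<Rightarrow> 'a \<Rightarrow> real) \<Rightarrow> bool" where
  "refines d d' \<longleftrightarrow> (\<forall>x y. d x y \<le> 2 * d' x y) \<and>
     (\<forall>z \<epsilon> w a. z \<in> core T \<longrightarrow> \<epsilon> > 0 \<longrightarrow> None \<in> set w \<longrightarrow>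
       (\<exists>x\<in>core T. d z x < \<epsilon> \<and> d' (weval (inst a w) x) (a 0) > 0))"

text \<open>There are countably many balls of \<open>d\<close> with centres in a dense sequence and radii \<open>(1/2) ^ l\<close>, and
  countably many shapes; the pseudometrics of \<open>admissible_refuting\<close> for all of them are joined with \<open>d\<close>.\<close>

lemma admissible_step:
  assumes d: "admissible d"
  shows "\<exists>d'. admissible d' \<and> refines d d'"
proof -
  interpret pseudometric d using d by (rule admissible_imp_pseudometric)
  obtain q where q: "dense_seq_on UNIV q" using admissible_separable[OF d] by blast
  define W where "W c = (case c of (j :: nat, l :: nat, w :: nat option list) \<Rightarrow> {x. d (q j) x < (1/2) ^ l})" for c
  define ok where "ok c \<longleftrightarrow> core T \<inter> W c \<noteq> {} \<and> None \<in> set (snd (snd c))" for c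
  have openW: "openin T (W c)" for c
  proof -
    obtain j l w where c: "c = (j, l, w)" by (metis prod_cases3)
    have "openin T {x \<in> topspace T. d (q j) x \<in> {..<(1/2) ^ l}}"
      using continuous_map_pseudometric[of T d T "\<lambda>_. q j" "\<lambda>x. x"] d
      by (intro openin_continuous_map_preimage) (auto simp: admissible_def)
    then show ?thesis by (simp add: W_def c)
  qed
  have "\<exists>d'. admissible d' \<and> (ok c \<longrightarrow>
      (\<forall>a. \<exists>x\<in>core T \<inter> W c. d' (weval (inst a (snd (snd c))) x) (a 0) > 0))" for c
  proof (cases "ok c")
    case True
    then have "core T \<inter> W c \<noteq> {}" "None \<in> set (snd (snd c))" by (auto simp: ok_def)
    from admissible_refuting[OF openW this] show ?thesis by metis
  qed (use d in blast)
  then obtain D where D: "\<And>c. admissible (D c)"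
    "\<And>c a. ok c \<Longrightarrow> \<exists>x\<in>core T \<inter> W c. D c (weval (inst a (snd (snd c))) x) (a 0) > 0" by metis
  define D' where "D' n = (case n of 0 \<Rightarrow> d | Suc m \<Rightarrow> D (from_nat m))" for n
  have adm: "admissible (D' n)" for n using d D(1) by (cases n) (simp_all add: D'_def)
  obtain d' where d': "admissible d'" "\<forall>n x y. D' n x y \<le> 2 ^ Suc n * d' x y"
    using admissible_join[of D', OF adm] by (elim exE conjE) (rule that)
  have "\<exists>x\<in>core T. d z x < \<epsilon> \<and> d' (weval (inst a w) x) (a 0) > 0"
    if z: "z \<in> core T" and \<epsilon>: "\<epsilon> > 0" and w: "None \<in> set w" for z \<epsilon> w a
  proof -
    obtain l where l: "(1/2 :: real) ^ l < \<epsilon> / 2" using real_arch_pow_inv[of "\<epsilon> / 2" "1/2"] \<epsilon> by auto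
    obtain j where j: "d (q j) z < (1/2) ^ l"
      using q unfolding dense_seq_on_def by (meson UNIV_I half_gt_zero_iff zero_less_one zero_less_power)
    define c where "c = (j, l, w)"
    have "ok c" using z w j by (auto simp: ok_def c_def W_def)
    from D(2)[OF this, of a] obtain x where x: "x \<in> core T" "x \<in> W c" "D c (weval (inst a w) x) (a 0) > 0"
      by (auto simp: c_def)
    have "d z x < \<epsilon>"
      using x(2) j l triangle[of z x "q j"] commute[of z "q j"] by (simp add: W_def c_def)
    moreover have "d' (weval (inst a w) x) (a 0) > 0"
    proof -
      have "0 < 2 ^ Suc (Suc (to_nat c)) * d' (weval (inst a w) x) (a 0)"
        using x(3) d'(2)[rule_format, of "Suc (to_nat c)" "weval (inst a w) x" "a 0"] by (simp add: D'_def)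
      then show ?thesis by (simp add: zero_less_mult_iff)
    qed
    ultimately show ?thesis using x(1) by blast
  qed
  moreover have "d x y \<le> 2 * d' x y" for x y using d'(2)[rule_format, of 0 x y] by (simp add: D'_def)
  ultimately have "refines d d'" unfolding refines_def by blast
  with d'(1) show ?thesis by blast
qed

text \<open>Iterate \<open>admissible_step\<close> and join the sequence. A ball of the join contains a ball of some \<open>D N\<close>, and
  \<open>D (N + 1)\<close> refutes all equations in it. So in the metrizable quotient defined by \<open>d\<close>, algebraic sets
  have empty interior relative to the core.\<close>

lemma admissible_generic:
  obtains d where "admissible d"
    "\<And>z \<epsilon> w b. z \<in> core T \<Longrightarrow> \<epsilon> > 0 \<Longrightarrow> None \<in> set w \<Longrightarrow>
       \<exists>x\<in>core T. d z x < \<epsilon> \<and> d (weval w x) b > 0"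
proof -
  have "\<exists>D. \<forall>n :: nat. admissible (D n) \<and> refines (D n) (D (Suc n))"
  proof (rule dependent_nat_choice)
    have "openin T UNIV" using openin_topspace[of T] by simp
    from admissible_separating[OF this] show "\<exists>d. admissible d" by blast
  qed (rule admissible_step)
  then obtain D where D: "\<And>n. admissible (D n)" "\<And>n. refines (D n) (D (Suc n))" by blast
  have D_mono: "D n x y \<le> 2 ^ k * D (n + k) x y" for n k x y
  proof (induction k)
    case (Suc k)
    have "D (n + k) x y \<le> 2 * D (Suc (n + k)) x y" using D(2) unfolding refines_def by blast
    then have "2 ^ k * D (n + k) x y \<le> 2 ^ k * (2 * D (Suc (n + k)) x y)" by (rule mult_left_mono) simp
    with Suc have "D n x y \<le> 2 ^ k * (2 * D (Suc (n + k)) x y)" by linarith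
    then show ?case by (simp add: mult.left_commute mult.assoc)
  qed simp
  obtain d where d: "admissible d" "\<forall>n x y. D n x y \<le> 2 ^ Suc n * d x y"
    "\<forall>\<epsilon>>0. \<exists>N. \<forall>x y. (\<forall>n\<le>N. D n x y < \<epsilon>) \<longrightarrow> d x y < 2 * \<epsilon>"
    using admissible_join[of D, OF D(1)] by (elim exE conjE) (rule that)
  have "\<exists>x\<in>core T. d z x < \<epsilon> \<and> d (weval w x) b > 0"
    if z: "z \<in> core T" and \<epsilon>: "\<epsilon> > 0" and w: "None \<in> set w" for z \<epsilon> w b
  proof -
    obtain a v where v: "inst a v = w" "a 0 = b" by (rule inst_parameters)
    obtain N where N: "\<And>x y. \<forall>n\<le>N. D n x y < \<epsilon> / 2 \<Longrightarrow> d x y < \<epsilon>"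
      using d(3)[rule_format, of "\<epsilon> / 2"] \<epsilon> by auto
    have "None \<in> set v" using w v(1) None_in_inst by metis
    moreover have "\<epsilon> / 2 / 2 ^ N > 0" using \<epsilon> by simp
    ultimately obtain x where x: "x \<in> core T" "D N z x < \<epsilon> / 2 / 2 ^ N"
      "D (Suc N) (weval w x) b > 0"
      using D(2)[of N] z v unfolding refines_def by metis
    have "D n z x < \<epsilon> / 2" if "n \<le> N" for n
    proof -
      have "D n z x \<le> 2 ^ (N - n) * D N z x" using D_mono[of n z x "N - n"] that by simp
      also have "\<dots> \<le> 2 ^ N * D N z x"
        using pseudometric.nonneg[OF admissible_imp_pseudometric[OF D(1)]] by (intro mult_right_mono) auto
      also have "\<dots> < \<epsilon> / 2" using x(2) by (simp add: field_simps)
      finally show ?thesis .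
    qed
    then have "d z x < \<epsilon>" using N by blast
    moreover have "d (weval w x) b > 0"
    proof -
      have "0 < 2 ^ Suc (Suc N) * d (weval w x) b" using d(2)[rule_format, of "Suc N" "weval w x" b] x(3) by linarith
      then show ?thesis by (simp add: zero_less_mult_iff)
    qed
    ultimately show ?thesis using x(1) by blast
  qed
  with d(1) that show thesis by blast
qed

lemma polybounded_compact:
  assumes cov: "cov_M =o |UNIV :: real set|" and zc: "zero_closed TYPE('a)"
  shows "polybounded TYPE('a)"
proof (cases "core T = {}")
  case True
  with zc show ?thesis by (rule polybounded_core_empty)
next
  case False
  obtain d where d: "admissible d"
    "\<And>z \<epsilon> w b. z \<in> core T \<Longrightarrow> \<epsilon> > 0 \<Longrightarrow> None \<in> set w \<Longrightarrow>
       \<exists>x\<in>core T. d z x < \<epsilon> \<and> d (weval w x) b > 0"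
    using admissible_generic by blast
  interpret subinvariant_pseudometric d using d(1) by (simp add: admissible_def)
  obtain q where q: "dense_seq_on UNIV q" using admissible_separable[OF d(1)] by blast
  have "closedin T (core T)" by (intro closedin_core continuous_weval) simp
  then have "complete_on (core T)" by (rule admissible_complete[OF d(1)])
  from algebraic_set_with_interior[OF cov zc q this False] obtain w b z \<epsilon>
    where "None \<in> set w" "z \<in> core T" "\<epsilon> > 0"
      "\<And>x. x \<in> core T \<Longrightarrow> d z x < \<epsilon> \<Longrightarrow> d (weval w x) b = 0" by metis
  with d(2) show ?thesis by (metis less_irrefl)
qed

end

theorem theorem3:
  assumes "cov_M =o |UNIV :: real set|"
    and "zero_closed TYPE('a::semigroup_mult)"
    and "(\<exists>d :: 'a \<Rightarrow> 'a \<Rightarrow> real.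
            Metric_space UNIV d \<and> Metric_space.mcomplete UNIV d \<and>
            separable_space (Metric_space.mtopology UNIV d) \<and> subinvariant d) \<or>
         (\<exists>T :: 'a topology.
            semigroup_topology T \<and> compact_space T \<and> Hausdorff_space T)"
  shows "polybounded TYPE('a)"
  using assms(3)
proof
  assume "\<exists>d :: 'a \<Rightarrow> 'a \<Rightarrow> real. Metric_space UNIV d \<and> Metric_space.mcomplete UNIV d \<and>
            separable_space (Metric_space.mtopology UNIV d) \<and> subinvariant d"
  then show ?thesis using polybounded_complete_metric[OF assms(1,2)] by blast
next
  assume "\<exists>T :: 'a topology. semigroup_topology T \<and> compact_space T \<and> Hausdorff_space T"
  then obtain T :: "'a topology" where "compact_semigroup T" by (auto simp: compact_semigroup_def)
  then show ?thesis using compact_semigroup.polybounded_compact[OF _ assms(1,2)] by blast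
qed

end
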